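(* Let $n\ge 8$, $t>0$, and $\Lambda=E_8\oplus\mathbb{Z}^{n-8}$. There is no sequence $(h_j)$ of even real-valued Schwartz functions on $\mathbb{R}^n$ with all of the following properties: (1) for every $j$, $h_j(x)\ge e^{-t\|x\|^2}$ for every nonzero $x$ in every unimodular integral lattice $\Lambda'\subset\mathbb{R}^n$; (2) for every $j$, $\widehat h_j(x)\le 0$ for every nonzero $x$ in every unimodular integral lattice $\Lambda'\subset\mathbb{R}^n$; (3) $\varepsilon_j:=1+\widehat h_j(0)-h_j(0)-\Theta_{\mathbb{Z}^n}(t)\to 0$ as $j\to\infty$; (4) the restrictions of $h_j$ and $\widehat h_j$ to $\Lambda$ are uniformly absolutely summable, i.e., there exist summable nonnegative families $(A_x)_{x\in\Lambda}$ and $(B_x)_{x\in\Lambda}$ such that $|h_j(x)|\le A_x$ and $|\widehat h_j(x)|\le B_x$ for all $x\in\Lambda$ and all $j$.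
   Context: A lattice in $\mathbb{R}^n$ means a full-rank lattice. It is integral if $\langle x,y\rangle\in\mathbb{Z}$ for all its elements $x,y$, and unimodular if its covolume is $1$. The Gaussian mass of a lattice $L$ is $\Theta_L(t)=\sum_{x\in L}e^{-t\|x\|^2}$ for $t>0$. The Fourier transform is $\widehat f(\xi)=\int_{\mathbb{R}^n}f(x)e^{-2\pi i\langle x,\xi\rangle}\,dx$; for $h$ real and even, $\widehat h$ is real-valued. $E_8=D_8\cup\bigl(D_8+(1/2,\ldots,1/2)\bigr)\subset\mathbb{R}^8$ with $D_8=\{x\in\mathbb{Z}^8:x_1+\cdots+x_8\equiv 0 \pmod 2\}$; $\oplus$ is the orthogonal direct sum (inside $\mathbb{R}^8\times\mathbb{R}^{n-8}=\mathbb{R}^n$), and $\mathbb{Z}^0=\{0\}$. *)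

theory Defs
  imports "HOL-Analysis.Analysis"
begin

definition integer_vectors :: "(real ^ 'n) set" where
  "integer_vectors = {x. \<forall>i. x $ i \<in> \<int>}"

text \<open>The columns of \<open>A\<close> are a \<open>\<int>\<close>-basis of \<open>L\<close>; invertibility expresses full rank.\<close>

definition lattice_basis :: "real ^ 'n ^ 'n \<Rightarrow> (real ^ 'n) set \<Rightarrow> bool" where
  "lattice_basis A L \<longleftrightarrow> invertible A \<and> L = (\<lambda>z. A *v z) ` integer_vectors"

definition is_lattice :: "(real ^ 'n) set \<Rightarrow> bool" where
  "is_lattice L \<longleftrightarrow> (\<exists>A. lattice_basis A L)"

text \<open>The choice of basis is immaterial, see \<open>covolume_eq\<close>.\<close>

definition covolume :: "(real ^ 'n) set \<Rightarrow> real" where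
  "covolume L = \<bar>det (SOME A. lattice_basis A L)\<bar>"

definition integral_lattice :: "(real ^ 'n) set \<Rightarrow> bool" where
  "integral_lattice L \<longleftrightarrow> is_lattice L \<and> (\<forall>x\<in>L. \<forall>y\<in>L. x \<bullet> y \<in> \<int>)"

definition unimodular_lattice :: "(real ^ 'n) set \<Rightarrow> bool" where
  "unimodular_lattice L \<longleftrightarrow> is_lattice L \<and> covolume L = 1"

lemma det_Ints:
  fixes M :: "real ^ 'n ^ 'n"
  assumes "\<And>i j. M $ i $ j \<in> \<int>"
  shows "det M \<in> \<int>"
  unfolding det_def using assms
  by (intro Ints_sum Ints_mult Ints_prod) auto

lemma lattice_basis_change:
  fixes A B :: "real ^ 'n ^ 'n"
  assumes "lattice_basis A L" "lattice_basis B L"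
  obtains M where "B = A ** M" "det M \<in> \<int>"
proof -
  have "\<exists>z. z \<in> integer_vectors \<and> B *v axis j 1 = A *v z" for j :: 'n
  proof -
    have "axis j 1 \<in> (integer_vectors :: (real ^ 'n) set)"
      by (auto simp: integer_vectors_def axis_def)
    then have "B *v axis j 1 \<in> L"
      using assms(2) by (auto simp: lattice_basis_def)
    then show ?thesis
      using assms(1) by (auto simp: lattice_basis_def)
  qed
  then obtain z where z: "\<And>j. z j \<in> integer_vectors" "\<And>j. B *v axis j 1 = A *v z j"
    by metis
  define M :: "real ^ 'n ^ 'n" where "M = (\<chi> i j. z j $ i)"
  have "M *v axis j 1 = z j" for j
    by (simp add: matrix_vector_mult_basis column_def M_def vec_eq_iff)
  then have "column j B = column j (A ** M)" for j
    using z(2)[of j]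
    by (simp flip: matrix_vector_mult_basis matrix_vector_mul_assoc)
  then have "B = A ** M"
    by (simp add: column_def vec_eq_iff)
  moreover have "det M \<in> \<int>"
    using z(1) by (intro det_Ints) (simp add: M_def integer_vectors_def)
  ultimately show thesis by (rule that)
qed

lemma lattice_basis_det_le:
  assumes "lattice_basis A L" "lattice_basis B L"
  shows "\<bar>det A\<bar> \<le> \<bar>det B\<bar>"
proof -
  obtain M where M: "B = A ** M" "det M \<in> \<int>"
    using lattice_basis_change[OF assms] .
  have "det B \<noteq> 0"
    using assms(2) by (simp add: lattice_basis_def invertible_det_nz)
  then have "det M \<noteq> 0" by (simp add: M det_mul)
  then have "1 \<le> \<bar>det M\<bar>"
    using M(2) by (simp add: Ints_nonzero_abs_ge1)
  then show ?thesis
    by (simp add: M det_mul abs_mult mult_le_cancel_left1)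
qed

lemma covolume_eq:
  assumes "lattice_basis A L"
  shows "covolume L = \<bar>det A\<bar>"
proof -
  have "lattice_basis (SOME A. lattice_basis A L) L"
    using assms by (rule someI)
  then show ?thesis
    unfolding covolume_def using lattice_basis_det_le assms by (metis order_antisym)
qed

definition gaussian_mass :: "(real ^ 'n) set \<Rightarrow> real \<Rightarrow> real" where
  "gaussian_mass L t = (\<Sum>\<^sub>\<infinity>x\<in>L. exp (- t * (norm x)\<^sup>2))"

definition D8 :: "(real ^ 8) set" where
  "D8 = {x \<in> integer_vectors. \<exists>k::int. (\<Sum>i\<in>UNIV. x $ i) = 2 * of_int k}"

definition E8 :: "(real ^ 8) set" where
  "E8 = D8 \<union> (\<lambda>x. x + (\<chi> i. 1 / 2)) ` D8"

text \<open>
  The injection \<open>e\<close> selects the eight coordinates of \<open>\<real>\<^sup>n\<close> which carry the factor \<open>\<real>\<^sup>8\<close>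
  in \<open>\<real>\<^sup>n = \<real>\<^sup>8 \<times> \<real>\<^sup>n\<^sup>-\<^sup>8\<close>; the remaining ones carry \<open>\<real>\<^sup>n\<^sup>-\<^sup>8\<close>.
  There are none of the latter if \<open>n = 8\<close>.
\<close>

definition E8_sum_integers :: "(8 \<Rightarrow> 'n) \<Rightarrow> (real ^ 'n) set" where
  "E8_sum_integers e =
     {x. (\<chi> i. x $ e i) \<in> E8 \<and> (\<forall>j. j \<notin> range e \<longrightarrow> x $ j \<in> \<int>)}"

definition partial_derivative ::
    "'n \<Rightarrow> (real ^ 'n \<Rightarrow> 'b::real_normed_vector) \<Rightarrow> real ^ 'n \<Rightarrow> 'b" where
  "partial_derivative i f x = frechet_derivative f (at x) (axis i 1)"

text \<open>A multi-index is represented by the list of coordinates of the successive derivatives.\<close>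

definition iterated_partial ::
    "'n list \<Rightarrow> (real ^ 'n \<Rightarrow> 'b::real_normed_vector) \<Rightarrow> real ^ 'n \<Rightarrow> 'b" where
  "iterated_partial is f = foldr partial_derivative is f"

definition smooth :: "(real ^ 'n \<Rightarrow> 'b::real_normed_vector) \<Rightarrow> bool" where
  "smooth f \<longleftrightarrow> (\<forall>is x. iterated_partial is f differentiable (at x))"

definition schwartz :: "(real ^ 'n \<Rightarrow> 'b::real_normed_vector) \<Rightarrow> bool" where
  "schwartz f \<longleftrightarrow> smooth f \<and>
     (\<forall>k is. bounded (range (\<lambda>x. norm x ^ k *\<^sub>R iterated_partial is f x)))"

definition even_fun :: "(real ^ 'n \<Rightarrow> real) \<Rightarrow> bool" where
  "even_fun f \<longleftrightarrow> (\<forall>x. f (- x) = f x)"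

definition fourier :: "(real ^ 'n \<Rightarrow> real) \<Rightarrow> real ^ 'n \<Rightarrow> complex" where
  "fourier f \<xi> =
     (LINT x|lborel. complex_of_real (f x) * exp (- 2 * of_real pi * \<i> * of_real (x \<bullet> \<xi>)))"

lemma lborel_distr_uminus_vec: "distr lborel borel uminus = (lborel :: (real ^ 'n) measure)"
  using lborel_affine[of "-1" "0 :: real ^ 'n"] by (simp add: density_1)

text \<open>
  By this lemma, nothing is lost by writing \<open>Re (fourier f \<xi>)\<close> where a real number is needed.
\<close>

lemma fourier_even_real:
  fixes f :: "real ^ 'n \<Rightarrow> real"
  assumes "schwartz f" "even_fun f"
  shows "fourier f \<xi> \<in> \<real>"
proof -
  let ?g = "\<lambda>x. complex_of_real (f x) * exp (- 2 * of_real pi * \<i> * of_real (x \<bullet> \<xi>))"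
  have "f differentiable (at x)" for x
  proof -
    have "iterated_partial [] f differentiable (at x)"
      using assms(1) unfolding schwartz_def smooth_def by blast
    then show ?thesis by (simp add: iterated_partial_def)
  qed
  then have "continuous_on UNIV f"
    by (simp add: continuous_at_imp_continuous_on differentiable_imp_continuous_within)
  then have "continuous_on UNIV ?g"
    by (intro continuous_intros)
  then have meas: "?g \<in> borel_measurable borel"
    by (rule borel_measurable_continuous_onI)
  have "fourier f \<xi> = (LINT x|distr lborel borel uminus. ?g x)"
    by (simp add: fourier_def lborel_distr_uminus_vec)
  also have "\<dots> = (LINT x|lborel. ?g (- x))"
    by (rule integral_distr[OF _ meas]) simp
  also have "\<dots> = (LINT x|lborel. cnj (?g x))"
    using assms(2) by (intro Bochner_Integration.integral_cong) (auto simp: even_fun_def exp_cnj)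
  also have "\<dots> = cnj (fourier f \<xi>)"
    unfolding fourier_def by (rule Bochner_Integration.integral_cnj)
  finally show ?thesis
    by (simp add: Reals_cnj_iff)
qed

end

theory Submission
  imports Defs
begin

text \<open>
  If \<open>O\<close> is orthogonal, Poisson summation over the lattice \<open>O \<int>\<^sup>n\<close> bounds every single slack
  \<open>h\<^sub>j(x) - exp (- t \<parallel>x\<parallel>\<^sup>2)\<close> and \<open>- h\<^sub>j^(x)\<close> with \<open>0 \<noteq> x \<in> O \<int>\<^sup>n\<close> by \<open>\<epsilon>\<^sub>j\<close>. Every vector of
  \<open>E\<^sub>8 \<oplus> \<int>\<^sup>n\<^sup>-\<^sup>8\<close> is as long as some integer vector, hence lies in some \<open>O \<int>\<^sup>n\<close>, so both slacks tend to
  \<open>0\<close> at every nonzero point of that lattice. By dominated convergence, Poisson summation over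
  \<open>E\<^sub>8 \<oplus> \<int>\<^sup>n\<^sup>-\<^sup>8\<close> then forces it to have the same Gaussian mass as \<open>\<int>\<^sup>n\<close>. In terms of
  theta constants this reads \<open>\<theta>\<^sub>2\<^sup>8 + \<theta>\<^sub>3\<^sup>8 + \<theta>\<^sub>4\<^sup>8 = 2 \<theta>\<^sub>3\<^sup>8\<close>, which Jacobi's identity
  \<open>\<theta>\<^sub>3\<^sup>4 = \<theta>\<^sub>2\<^sup>4 + \<theta>\<^sub>4\<^sup>4\<close> turns into \<open>\<theta>\<^sub>2 \<theta>\<^sub>4 = 0\<close>.
\<close>

section \<open>Theta constants\<close>

text \<open>The argument runs on continuity and polynomial decay of \<open>h j\<close>, which say
  nothing about summability of its Fourier transform. Over rotated copies of \<open>\<int>^n\<close>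
  the dual sum is therefore replaced by Fejer means. Their weights lie in \<open>[0, 1]\<close> and
  tend to \<open>1\<close>; together with condition (2) this gives a one-sided Poisson estimate,
  which is enough to isolate a single slack. That every slack is small does not make the sum of the
  slacks over an infinite lattice small; this is where condition (4) acts. Its family
  \<open>B\<close> also turns Fejer means into genuine sums over \<open>E8_sum_integers e\<close>,
  where equality is needed. A half-integral vector becomes an integral one of the same length by
  reflecting four coordinates at a time in the hyperplane orthogonal to a vector of signs. Both
  Jacobi's identity and the nonvanishing of \<open>theta4\<close> come from the map
  \<open>(u, v) \<mapsto> (u + v, u - v)\<close>, which relates the arguments \<open>t\<close> and
  \<open>2 * t\<close>: a zero of \<open>theta4\<close> would recur along \<open>2 ^ k * t\<close>,
  where \<open>theta4\<close> is close to \<open>1\<close>.\<close>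

definition theta2 :: "real \<Rightarrow> real" where
  "theta2 t = (\<Sum>\<^sub>\<infinity>k::int. exp (- t * (of_int k + 1 / 2)\<^sup>2))"

definition theta3 :: "real \<Rightarrow> real" where
  "theta3 t = (\<Sum>\<^sub>\<infinity>k::int. exp (- t * (of_int k)\<^sup>2))"

definition alt_sign :: "int \<Rightarrow> real" where
  "alt_sign k = (if even k then 1 else - 1)"

definition theta4 :: "real \<Rightarrow> real" where
  "theta4 t = (\<Sum>\<^sub>\<infinity>k::int. alt_sign k * exp (- t * (of_int k)\<^sup>2))"

lemma summable_on_inverse_1_plus_square_int:
  "(\<lambda>k::int. inverse (1 + (of_int k)\<^sup>2) :: real) summable_on UNIV"
proof -
  let ?f = "\<lambda>k::int. inverse (1 + (of_int k)\<^sup>2) :: real"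
  have "summable (\<lambda>n. norm (inverse (1 + (real n)\<^sup>2)))"
  proof (rule summable_comparison_test')
    show "summable (\<lambda>n. inverse (real n ^ 2))" by (rule inverse_power_summable) simp
    show "norm (norm (inverse (1 + (real n)\<^sup>2))) \<le> inverse (real n ^ 2)" if "n \<ge> 1" for n
      using that by (auto intro!: le_imp_inverse_le)
  qed
  then have nat: "(\<lambda>n. inverse (1 + (real n)\<^sup>2)) summable_on UNIV"
    by (rule norm_summable_imp_summable_on)
  have "?f summable_on range int"
    using nat by (subst summable_on_reindex) (auto simp: o_def)
  moreover have "?f summable_on range (\<lambda>n. - int n)"
    using nat by (subst summable_on_reindex) (auto simp: inj_def o_def)
  ultimately have "?f summable_on (range int \<union> range (\<lambda>n. - int n))"
    by (rule summable_on_union)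
  moreover have "k \<in> range int \<union> range (\<lambda>n. - int n)" for k
    by (cases k rule: int_cases2) auto
  then have "range int \<union> range (\<lambda>n. - int n) = UNIV" by blast
  ultimately show ?thesis by simp
qed

lemma summable_on_gaussian_int:
  fixes t a :: real
  assumes t: "t > 0"
  shows "(\<lambda>k::int. exp (- t * (of_int k + a)\<^sup>2)) summable_on UNIV"
proof (rule summable_on_comparison_test)
  \<comment> \<open>Chosen so that \<open>(1 + 2 * a\<^sup>2) + 2 * y \<le> C * (1 + t * y)\<close>
    for all \<open>y \<ge> 0\<close>, with one entry of the maximum for each coefficient; the
    exponential then dominates \<open>1 + t * y\<close>.\<close>
  define C where "C = max (1 + 2 * a\<^sup>2) (2 / t)"
  show "(\<lambda>k::int. C * inverse (1 + (of_int k)\<^sup>2)) summable_on UNIV"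
    by (intro summable_on_cmult_right summable_on_inverse_1_plus_square_int)
  fix k :: int
  let ?y = "(of_int k + a)\<^sup>2"
  have y: "?y \<ge> 0" by simp
  \<comment> \<open>The right side exceeds the left by \<open>(k + 2 * a)\<^sup>2\<close>.\<close>
  have "(of_int k)\<^sup>2 \<le> 2 * ?y + 2 * a\<^sup>2"
    using zero_le_power2[of "of_int k + 2 * a"] by (simp add: power2_eq_square algebra_simps)
  then have "1 + (of_int k)\<^sup>2 \<le> (1 + 2 * a\<^sup>2) + 2 * ?y" by simp
  also have "\<dots> \<le> C + C * (t * ?y)"
  proof -
    have "2 / t \<le> C" "1 + 2 * a\<^sup>2 \<le> C" by (auto simp: C_def)
    then have "2 \<le> C * t" using t by (simp add: pos_divide_le_eq)
    then have "2 * ?y \<le> C * t * ?y" by (intro mult_right_mono) auto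
    with \<open>1 + 2 * a\<^sup>2 \<le> C\<close> show ?thesis by (simp add: mult.assoc)
  qed
  also have "\<dots> = C * (1 + t * ?y)" by (simp add: algebra_simps)
  also have "\<dots> \<le> C * exp (t * ?y)"
  proof (rule mult_left_mono)
    show "1 + t * ?y \<le> exp (t * ?y)" by (rule exp_ge_add_one_self)
    show "0 \<le> C" by (simp add: C_def le_max_iff_disj)
  qed
  finally have *: "1 + (of_int k)\<^sup>2 \<le> C * exp (t * ?y)" .
  have "0 < 1 + (real_of_int k)\<^sup>2" by (auto intro: add_pos_nonneg)
  with * show "exp (- t * ?y) \<le> C * inverse (1 + (of_int k)\<^sup>2)"
    by (simp add: exp_minus divide_simps mult.commute)
qed simp

lemma summable_on_alt_gaussian_int:
  assumes "t > 0"
  shows "(\<lambda>k::int. alt_sign k * exp (- t * (of_int k + a)\<^sup>2)) summable_on UNIV"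
    and "(\<lambda>k::int. norm (alt_sign k * exp (- t * (of_int k + a)\<^sup>2))) summable_on UNIV"
proof -
  show *: "(\<lambda>k::int. norm (alt_sign k * exp (- t * (of_int k + a)\<^sup>2))) summable_on UNIV"
    using summable_on_gaussian_int[OF assms, of a]
    by (rule summable_on_cong[THEN iffD1, rotated]) (auto simp: alt_sign_def abs_mult)
  show "(\<lambda>k::int. alt_sign k * exp (- t * (of_int k + a)\<^sup>2)) summable_on UNIV"
    using * by (rule abs_summable_summable)
qed

lemma product_sum_int:
  fixes f g :: "int \<Rightarrow> real"
  assumes f: "(\<lambda>x. norm (f x)) summable_on UNIV" and g: "(\<lambda>x. norm (g x)) summable_on UNIV"
  shows "(\<lambda>(x, y). f x * g y) summable_on UNIV"
    and "infsum f UNIV * infsum g UNIV = (\<Sum>\<^sub>\<infinity>(x, y). f x * g y)"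
proof -
  have "(\<lambda>p. norm ((\<lambda>(x, y). f x * g y) p)) summable_on (UNIV \<times> UNIV)"
  proof (subst Infinite_Sum.abs_summable_on_Sigma_iff, intro conjI ballI)
    show "(\<lambda>y. norm (case (x, y) of (x, y) \<Rightarrow> f x * g y)) summable_on UNIV" for x
      using summable_on_cmult_right[OF g, of "norm (f x)"] by (simp add: abs_mult)
    show "(\<lambda>x. norm (\<Sum>\<^sub>\<infinity>y. norm (case (x, y) of (x, y) \<Rightarrow> f x * g y))) summable_on UNIV"
      using summable_on_cmult_left[OF f, of "\<Sum>\<^sub>\<infinity>y. norm (g y)"]
      by (simp add: abs_mult infsum_cmult_right' infsum_nonneg)
  qed
  then have s: "(\<lambda>(x, y). f x * g y) summable_on (UNIV \<times> UNIV)"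
    by (rule abs_summable_summable)
  then show "(\<lambda>(x, y). f x * g y) summable_on UNIV" by simp
  show "infsum f UNIV * infsum g UNIV = (\<Sum>\<^sub>\<infinity>(x, y). f x * g y)"
    using infsum_Sigma_banach[OF s] by (simp add: infsum_cmult_right' infsum_cmult_left')
qed

text \<open>The image of \<open>(u, v) \<mapsto> (u + v, u - v)\<close> is the sublattice of index
  two given by an even coordinate sum, and the shifted map covers its other coset. Since \<open>(u +
  v)\<^sup>2 + (u - v)\<^sup>2 = 2 * (u\<^sup>2 + v\<^sup>2)\<close>, Gaussian sums at
  \<open>t\<close> turn into Gaussian sums at \<open>2 * t\<close>.\<close>

lemma infsum_int_square_split:
  fixes F :: "int \<times> int \<Rightarrow> real"
  assumes F: "F summable_on UNIV"
  shows "infsum F UNIV = (\<Sum>\<^sub>\<infinity>(u, v). F (u + v, u - v)) + (\<Sum>\<^sub>\<infinity>(u, v). F (u + v + 1, u - v))"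
    and "(\<lambda>(u, v). F (u + v, u - v)) summable_on UNIV"
    and "(\<lambda>(u, v). F (u + v + 1, u - v)) summable_on UNIV"
proof -
  let ?A = "{p :: int \<times> int. even (fst p + snd p)}" and ?B = "{p :: int \<times> int. odd (fst p + snd p)}"
  have A: "bij_betw (\<lambda>(u, v). (u + v, u - v)) UNIV ?A"
    unfolding bij_betw_def
  proof
    show "(\<lambda>(u, v). (u + v, u - v)) ` UNIV = ?A"
    proof (intro equalityI subsetI)
      fix p assume "p \<in> ?A"
      then have "even (fst p + snd p)" by simp
      then obtain k where "fst p + snd p = 2 * k" by (rule evenE)
      then show "p \<in> (\<lambda>(u, v). (u + v, u - v)) ` UNIV"
        by (intro image_eqI[where x = "(k, fst p - k)"]) (auto simp: prod_eq_iff)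
    qed auto
  qed (auto simp: inj_on_def)
  have B: "bij_betw (\<lambda>(u, v). (u + v + 1, u - v)) UNIV ?B"
    unfolding bij_betw_def
  proof
    show "(\<lambda>(u, v). (u + v + 1, u - v)) ` UNIV = ?B"
    proof (intro equalityI subsetI)
      fix p assume "p \<in> ?B"
      then have "odd (fst p + snd p)" by simp
      then obtain k where "fst p + snd p = 2 * k + 1" by (rule oddE)
      then show "p \<in> (\<lambda>(u, v). (u + v + 1, u - v)) ` UNIV"
        by (intro image_eqI[where x = "(k, fst p - 1 - k)"]) (auto simp: prod_eq_iff)
    qed auto
  qed (auto simp: inj_on_def)
  have "infsum F UNIV = infsum F (?A \<union> ?B)" by (rule arg_cong[where f = "infsum F"]) auto
  also have "\<dots> = infsum F ?A + infsum F ?B"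
    by (rule infsum_Un_disjoint) (auto intro: summable_on_subset_banach[OF F])
  also have "infsum F ?A = (\<Sum>\<^sub>\<infinity>(u, v). F (u + v, u - v))"
    using infsum_reindex_bij_betw[OF A, of F] by (simp add: case_prod_unfold)
  also have "infsum F ?B = (\<Sum>\<^sub>\<infinity>(u, v). F (u + v + 1, u - v))"
    using infsum_reindex_bij_betw[OF B, of F] by (simp add: case_prod_unfold)
  finally show "infsum F UNIV = (\<Sum>\<^sub>\<infinity>(u, v). F (u + v, u - v)) + (\<Sum>\<^sub>\<infinity>(u, v). F (u + v + 1, u - v))" .
  show "(\<lambda>(u, v). F (u + v, u - v)) summable_on UNIV"
    using summable_on_reindex_bij_betw[OF A, of F] summable_on_subset_banach[OF F, of ?A] by (simp add: case_prod_unfold)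
  show "(\<lambda>(u, v). F (u + v + 1, u - v)) summable_on UNIV"
    using summable_on_reindex_bij_betw[OF B, of F] summable_on_subset_banach[OF F, of ?B] by (simp add: case_prod_unfold)
qed

lemma gaussian_int_pair:
  fixes t a b :: real
  assumes "t > 0"
  shows "(\<Sum>\<^sub>\<infinity>k::int. exp (- t * (of_int k + a)\<^sup>2)) * (\<Sum>\<^sub>\<infinity>k::int. exp (- t * (of_int k + b)\<^sup>2))
    = (\<Sum>\<^sub>\<infinity>(x, y). exp (- t * ((of_int x + a)\<^sup>2 + (of_int y + b)\<^sup>2)))"
    and "(\<lambda>(x :: int, y :: int). exp (- t * ((of_int x + a)\<^sup>2 + (of_int y + b)\<^sup>2))) summable_on UNIV"
proof -
  have eq: "exp (- t * (of_int x + a)\<^sup>2) * exp (- t * (of_int y + b)\<^sup>2) = exp (- t * ((of_int x + a)\<^sup>2 + (of_int y + b)\<^sup>2))" for x y :: int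
    unfolding mult_exp_exp by (simp add: algebra_simps)
  have n: "(\<lambda>k::int. norm (exp (- t * (of_int k + c)\<^sup>2))) summable_on UNIV" for c
    using summable_on_gaussian_int[OF assms, of c] by simp
  note * = product_sum_int[OF n[of a] n[of b], unfolded eq]
  show "(\<Sum>\<^sub>\<infinity>k::int. exp (- t * (of_int k + a)\<^sup>2)) * (\<Sum>\<^sub>\<infinity>k::int. exp (- t * (of_int k + b)\<^sup>2))
    = (\<Sum>\<^sub>\<infinity>(x, y). exp (- t * ((of_int x + a)\<^sup>2 + (of_int y + b)\<^sup>2)))" by (rule *(2))
  show "(\<lambda>(x :: int, y :: int). exp (- t * ((of_int x + a)\<^sup>2 + (of_int y + b)\<^sup>2))) summable_on UNIV" by (rule *(1))
qed

section \<open>Duplication formulas and Jacobi's identity\<close>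

lemma theta3_shift: "(\<Sum>\<^sub>\<infinity>k::int. exp (- t * (of_int k + 1)\<^sup>2)) = theta3 t"
proof -
  have "bij_betw (\<lambda>k::int. k + 1) UNIV UNIV"
    by (rule bij_betwI[where g = "\<lambda>k. k - 1"]) auto
  from infsum_reindex_bij_betw[OF this, of "\<lambda>k. exp (- t * (of_int k)\<^sup>2)"] show ?thesis
    by (simp add: theta3_def)
qed

text \<open>The two cosets yield the offsets \<open>(1 / 2, 0)\<close> and \<open>(1, 1 / 2)\<close>
  in the new coordinates. Up to an integer shift both give the same product, hence the factor
  \<open>2\<close>.\<close>

lemma theta2_sq:
  assumes t: "t > 0"
  shows "(theta2 t)\<^sup>2 = 2 * theta2 (2 * t) * theta3 (2 * t)"
proof -
  have t2: "2 * t > 0" using t by simp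
  let ?F = "\<lambda>(x :: int, y :: int). exp (- t * ((of_int x + 1 / 2)\<^sup>2 + (of_int y + 1 / 2)\<^sup>2))"
  have "theta2 t * theta2 t = infsum ?F UNIV"
    unfolding theta2_def by (rule gaussian_int_pair(1)[OF t])
  also have "\<dots> = (\<Sum>\<^sub>\<infinity>(u, v). ?F (u + v, u - v)) + (\<Sum>\<^sub>\<infinity>(u, v). ?F (u + v + 1, u - v))"
    by (rule infsum_int_square_split(1)[OF gaussian_int_pair(2)[OF t]])
  also have "(\<lambda>(u, v). ?F (u + v, u - v)) = (\<lambda>(u, v). exp (- (2 * t) * ((of_int u + 1 / 2)\<^sup>2 + (of_int v + 0)\<^sup>2)))"
    by (intro ext) (auto simp: power2_eq_square algebra_simps)
  also have "(\<lambda>(u, v). ?F (u + v + 1, u - v)) = (\<lambda>(u, v). exp (- (2 * t) * ((of_int u + 1)\<^sup>2 + (of_int v + 1 / 2)\<^sup>2)))"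
    by (intro ext) (auto simp: power2_eq_square algebra_simps)
  finally show ?thesis
    unfolding gaussian_int_pair(1)[OF t2, symmetric] theta3_shift by (simp add: theta2_def theta3_def power2_eq_square)
qed

lemma theta3_sq:
  assumes t: "t > 0"
  shows "(theta3 t)\<^sup>2 = (theta3 (2 * t))\<^sup>2 + (theta2 (2 * t))\<^sup>2"
proof -
  have t2: "2 * t > 0" using t by simp
  let ?F = "\<lambda>(x :: int, y :: int). exp (- t * ((of_int x + 0)\<^sup>2 + (of_int y + 0)\<^sup>2))"
  have th: "theta3 t = (\<Sum>\<^sub>\<infinity>k::int. exp (- t * (of_int k + 0)\<^sup>2))"
    by (simp add: theta3_def)
  have "theta3 t * theta3 t = infsum ?F UNIV"
    unfolding th by (rule gaussian_int_pair(1)[OF t])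
  also have "\<dots> = (\<Sum>\<^sub>\<infinity>(u, v). ?F (u + v, u - v)) + (\<Sum>\<^sub>\<infinity>(u, v). ?F (u + v + 1, u - v))"
    by (rule infsum_int_square_split(1)[OF gaussian_int_pair(2)[OF t]])
  also have "(\<lambda>(u, v). ?F (u + v, u - v)) = (\<lambda>(u, v). exp (- (2 * t) * ((of_int u + 0)\<^sup>2 + (of_int v + 0)\<^sup>2)))"
    by (intro ext) (auto simp: power2_eq_square algebra_simps)
  also have "(\<lambda>(u, v). ?F (u + v + 1, u - v)) = (\<lambda>(u, v). exp (- (2 * t) * ((of_int u + 1 / 2)\<^sup>2 + (of_int v + 1 / 2)\<^sup>2)))"
    by (intro ext) (auto simp: power2_eq_square algebra_simps)
  finally show ?thesis
    unfolding gaussian_int_pair(1)[OF t2, symmetric] by (simp add: theta2_def theta3_def power2_eq_square)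
qed

text \<open>The sign of a pair depends on the parity of its coordinate sum: it is \<open>1\<close>
  on the first coset and \<open>- 1\<close> on the second. This is the only change from
  \<open>theta3_sq\<close>.\<close>

lemma theta4_sq:
  assumes t: "t > 0"
  shows "(theta4 t)\<^sup>2 = (theta3 (2 * t))\<^sup>2 - (theta2 (2 * t))\<^sup>2"
proof -
  have t2: "2 * t > 0" using t by simp
  let ?F = "\<lambda>(x :: int, y :: int). alt_sign x * exp (- t * (of_int x + 0)\<^sup>2) * (alt_sign y * exp (- t * (of_int y + 0)\<^sup>2))"
  note p = product_sum_int[OF summable_on_alt_gaussian_int(2)[OF t, of 0] summable_on_alt_gaussian_int(2)[OF t, of 0]]
  have eq: "?F (x, y) = (if even (x + y) then 1 else - 1) * exp (- t * ((of_int x)\<^sup>2 + (of_int y)\<^sup>2))" for x y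
    by (auto simp: alt_sign_def exp_add[symmetric] algebra_simps)
  have th: "theta4 t = (\<Sum>\<^sub>\<infinity>k::int. alt_sign k * exp (- t * (of_int k + 0)\<^sup>2))"
    by (simp add: theta4_def)
  have "theta4 t * theta4 t = infsum ?F UNIV"
    unfolding th by (rule p(2))
  also have "\<dots> = (\<Sum>\<^sub>\<infinity>(u, v). ?F (u + v, u - v)) + (\<Sum>\<^sub>\<infinity>(u, v). ?F (u + v + 1, u - v))"
    by (rule infsum_int_square_split(1)[OF p(1)])
  also have "(\<lambda>(u, v). ?F (u + v, u - v)) = (\<lambda>(u, v). exp (- (2 * t) * ((of_int u + 0)\<^sup>2 + (of_int v + 0)\<^sup>2)))"
    unfolding eq by (intro ext) (auto simp: power2_eq_square algebra_simps)
  also have "(\<lambda>(u, v). ?F (u + v + 1, u - v)) = (\<lambda>(u, v). - 1 * (case (u, v) of (u, v) \<Rightarrow> exp (- (2 * t) * ((of_int u + 1 / 2)\<^sup>2 + (of_int v + 1 / 2)\<^sup>2))))"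
    unfolding eq by (intro ext) (auto simp: power2_eq_square algebra_simps)
  also have "(\<Sum>\<^sub>\<infinity>(u, v). - 1 * (case (u, v) of (u :: int, v :: int) \<Rightarrow> exp (- (2 * t) * ((of_int u + 1 / 2)\<^sup>2 + (of_int v + 1 / 2)\<^sup>2))))
    = - (\<Sum>\<^sub>\<infinity>(u :: int, v :: int). exp (- (2 * t) * ((of_int u + 1 / 2)\<^sup>2 + (of_int v + 1 / 2)\<^sup>2)))"
    by (simp add: case_prod_unfold infsum_uminus)
  finally show ?thesis
    unfolding gaussian_int_pair(1)[OF t2, symmetric] by (simp add: theta2_def theta3_def power2_eq_square)
qed

text \<open>In terms of \<open>A = theta3 (2 * t)\<close> and \<open>B = theta2 (2 * t)\<close> this
  is \<open>(A\<^sup>2 + B\<^sup>2)\<^sup>2 = (2 * A * B)\<^sup>2 + (A\<^sup>2 -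
  B\<^sup>2)\<^sup>2\<close>. The nome of the theta constants is \<open>exp (- t)\<close>.\<close>

lemma theta_jacobi:
  assumes "t > 0"
  shows "theta3 t ^ 4 = theta2 t ^ 4 + theta4 t ^ 4"
proof -
  have *: "x ^ 4 = (x\<^sup>2)\<^sup>2" for x :: real by (simp flip: power_mult)
  show ?thesis
    unfolding * theta2_sq[OF assms] theta3_sq[OF assms] theta4_sq[OF assms]
    by (simp add: power2_eq_square algebra_simps)
qed

text \<open>A consequence of the classical
  \<open>theta4 (2 * t)\<^sup>2 = theta3 t * theta4 t\<close>, used here in squared form, which
  avoids a discussion of signs.\<close>

lemma theta4_double:
  assumes "t > 0" "theta4 t = 0"
  shows "theta4 (2 * t) = 0"
proof -
  have "theta4 (2 * t) ^ 4 = theta3 (2 * t) ^ 4 - theta2 (2 * t) ^ 4"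
    using theta_jacobi[of "2 * t"] assms by simp
  also have "\<dots> = (theta4 t)\<^sup>2 * (theta3 t)\<^sup>2"
    unfolding theta4_sq[OF assms(1)] theta3_sq[OF assms(1)] by (simp add: power2_eq_square power4_eq_xxxx algebra_simps)
  finally show ?thesis using assms by simp
qed

section \<open>Positivity and nonvanishing\<close>

lemma theta_pos:
  assumes "t > 0"
  shows "theta2 t > 0" "theta3 t > 0"
proof -
  have *: "(\<Sum>\<^sub>\<infinity>k::int. exp (- t * (of_int k + a)\<^sup>2)) > 0" for a
  proof -
    have "exp (- t * a\<^sup>2) = infsum (\<lambda>k::int. exp (- t * (of_int k + a)\<^sup>2)) {0}" by simp
    also have "\<dots> \<le> (\<Sum>\<^sub>\<infinity>k::int. exp (- t * (of_int k + a)\<^sup>2))"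
      by (rule infsum_mono_neutral) (use summable_on_gaussian_int[OF assms] in auto)
    finally show ?thesis using exp_gt_zero less_le_trans by blast
  qed
  show "theta2 t > 0" "theta3 t > 0"
    using *[of "1 / 2"] *[of 0] by (auto simp: theta2_def theta3_def)
qed

text \<open>For \<open>k \<noteq> 0\<close> one has
  \<open>s * k\<^sup>2 \<ge> (s - 1) + k\<^sup>2\<close>, so a factor \<open>exp (- (s - 1))\<close>
  splits off from every term but the one at \<open>0\<close>, and a sum that does not depend on
  \<open>s\<close> remains.\<close>

lemma theta4_bound:
  assumes s: "s \<ge> 1"
  shows "\<bar>theta4 s - 1\<bar> \<le> exp (- (s - 1)) * theta3 1"
proof -
  have s0: "s > 0" using s by simp
  let ?f = "\<lambda>k::int. alt_sign k * exp (- s * (of_int k + 0)\<^sup>2)"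
  let ?g = "\<lambda>k::int. exp (- (s - 1)) * exp (- 1 * (of_int k + 0)\<^sup>2)"
  have f: "?f summable_on A" for A
    using summable_on_alt_gaussian_int(1)[OF s0, of 0] by (rule summable_on_subset_banach) simp
  have g: "?g summable_on A" for A
    using summable_on_cmult_right[OF summable_on_gaussian_int[of 1 0]] by (rule summable_on_subset_banach) simp_all
  have le: "norm (?f k) \<le> ?g k" if "k \<noteq> 0" for k
  proof -
    have "\<bar>k\<bar> \<ge> 1" using that by linarith
    then have "k\<^sup>2 \<ge> 1" by (simp add: abs_le_square_iff[of 1 k, simplified])
    then have "(real_of_int k)\<^sup>2 \<ge> 1" by (metis of_int_1_le_iff of_int_power)
    then have "(s - 1) * 1 \<le> (s - 1) * (real_of_int k)\<^sup>2" using s by (intro mult_left_mono) auto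
    then have "- s * (real_of_int k)\<^sup>2 \<le> - (s - 1) + - 1 * (real_of_int k)\<^sup>2" by (simp add: algebra_simps)
    then have "exp (- s * (real_of_int k)\<^sup>2) \<le> exp (- (s - 1)) * exp (- 1 * (real_of_int k)\<^sup>2)"
      unfolding mult_exp_exp by simp
    then show ?thesis by (auto simp: alt_sign_def abs_mult)
  qed
  have "theta4 s = infsum ?f ({0} \<union> (UNIV - {0}))"
    by (simp add: theta4_def)
  also have "\<dots> = infsum ?f {0} + infsum ?f (UNIV - {0})"
    by (rule infsum_Un_disjoint[OF f f]) simp
  finally have "theta4 s - 1 = infsum ?f (UNIV - {0})" by (simp add: alt_sign_def)
  also have "\<bar>\<dots>\<bar> \<le> infsum ?g (UNIV - {0})"
  proof -
    have "norm (infsum ?f (UNIV - {0})) \<le> infsum ?g (UNIV - {0})"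
      by (rule norm_infsum_le[OF has_sum_infsum[OF f] has_sum_infsum[OF g]]) (use le in auto)
    then show ?thesis by simp
  qed
  also have "\<dots> \<le> infsum ?g UNIV"
    by (rule infsum_mono_neutral[OF g g]) auto
  also have "\<dots> = exp (- (s - 1)) * theta3 1"
    by (simp add: theta3_def infsum_cmult_right')
  finally show ?thesis .
qed

lemma theta4_nonzero:
  assumes "t > 0"
  shows "theta4 t \<noteq> 0"
proof
  assume 0: "theta4 t = 0"
  have z: "theta4 (2 ^ k * t) = 0" for k
  proof (induction k)
    case (Suc k)
    then show ?case using theta4_double[of "2 ^ k * t"] assms by (simp add: mult.assoc)
  qed (use 0 in simp)
  \<comment> \<open>With \<open>s = 2 ^ k * t\<close>, the bound \<open>s > 1\<close> makes
    \<open>theta4_bound\<close> applicable, and \<open>s > theta3 1\<close> makes its right side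
    less than \<open>1\<close>, because \<open>exp (s - 1) \<ge> s\<close>.\<close>
  obtain k where "max 1 (theta3 1) / t < 2 ^ k"
    using real_arch_pow[of 2] by auto
  then have s: "2 ^ k * t > 1" "2 ^ k * t > theta3 1"
    using assms by (auto simp: pos_divide_less_eq)
  have "exp (- (2 ^ k * t - 1)) \<le> 1 / (2 ^ k * t)"
    using exp_ge_add_one_self[of "2 ^ k * t - 1"] s(1) unfolding exp_minus inverse_eq_divide[symmetric]
    by (intro le_imp_inverse_le) auto
  then have "exp (- (2 ^ k * t - 1)) * theta3 1 \<le> 1 / (2 ^ k * t) * theta3 1"
    using theta_pos(2)[of 1] by (intro mult_right_mono) auto
  also have "\<dots> < 1" using s by (simp add: divide_simps)
  finally show False using theta4_bound[of "2 ^ k * t"] z[of k] s(1) by simp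
qed

lemma theta_E8_neq:
  assumes "t > 0"
  shows "theta2 t ^ 8 + theta3 t ^ 8 + theta4 t ^ 8 \<noteq> 2 * theta3 t ^ 8"
proof
  assume *: "theta2 t ^ 8 + theta3 t ^ 8 + theta4 t ^ 8 = 2 * theta3 t ^ 8"
  have 8: "x ^ 8 = (x ^ 4)\<^sup>2" for x :: real by (simp flip: power_mult)
  \<comment> \<open>With \<open>a = theta2 t ^ 4\<close> and \<open>b = theta4 t ^ 4\<close> the
    assumption reads \<open>a\<^sup>2 + (a + b)\<^sup>2 + b\<^sup>2 = 2 * (a +
    b)\<^sup>2\<close>.\<close>
  have "2 * theta2 t ^ 4 * theta4 t ^ 4 = 0"
    using * unfolding 8 theta_jacobi[OF assms] by (simp add: power2_eq_square algebra_simps)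
  then show False using theta_pos(1)[OF assms] theta4_nonzero[OF assms] by simp
qed

section \<open>Orthogonal invariance of Lebesgue measure\<close>

lemma lborel_distr_uminus_euclidean: "distr lborel borel uminus = (lborel :: 'a::euclidean_space measure)"
  using lborel_affine[of "-1" "0 :: 'a"] by (simp add: density_1)

lemma nn_integral_lborel_translate:
  fixes u :: "'a::euclidean_space \<Rightarrow> ennreal"
  assumes [measurable]: "u \<in> borel_measurable borel"
  shows "(\<integral>\<^sup>+x. u (v + x) \<partial>lborel) = (\<integral>\<^sup>+x. u x \<partial>lborel)"
proof -
  have "(\<integral>\<^sup>+x. u x \<partial>lborel) = (\<integral>\<^sup>+x. u x \<partial>distr lborel borel ((+) v))"
    by (simp add: lborel_distr_plus)
  also have "\<dots> = (\<integral>\<^sup>+x. u (v + x) \<partial>lborel)"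
    by (subst nn_integral_distr) auto
  finally show ?thesis by simp
qed

lemma nn_integral_lborel_uminus:
  fixes u :: "'a::euclidean_space \<Rightarrow> ennreal"
  assumes [measurable]: "u \<in> borel_measurable borel"
  shows "(\<integral>\<^sup>+x. u (- x) \<partial>lborel) = (\<integral>\<^sup>+x. u x \<partial>lborel)"
proof -
  have "(\<integral>\<^sup>+x. u x \<partial>lborel) = (\<integral>\<^sup>+x. u x \<partial>distr lborel borel uminus)"
    by (simp add: lborel_distr_uminus_euclidean)
  also have "\<dots> = (\<integral>\<^sup>+x. u (- x) \<partial>lborel)"
    by (subst nn_integral_distr) auto
  finally show ?thesis by simp
qed

text \<open>
  The change-of-variables theorems of the library need a wellordered index type; for an arbitrary
  finite one, orthogonal invariance follows from the uniqueness of Haar measure.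
\<close>

lemma lborel_distr_orthogonal:
  fixes f :: "'a::euclidean_space \<Rightarrow> 'a"
  assumes f: "orthogonal_transformation f"
  shows "distr lborel borel f = lborel"
proof -
  let ?L = "lborel :: 'a measure"
  have lin: "linear f" using f by (rule orthogonal_transformation_linear)
  have cont: "continuous_on UNIV f" using lin by (rule linear_continuous_on[OF linear_conv_bounded_linear[THEN iffD1]])
  have [measurable]: "f \<in> borel_measurable borel"
    using cont by (rule borel_measurable_continuous_onI)
  have nf: "norm (f x) = norm x" for x using f by (rule orthogonal_transformation_norm)
  obtain g where g: "\<And>x. f (g x) = x" 
    using orthogonal_transformation_surj[OF f] by (metis surjD)
  have tr: "(\<integral>\<^sup>+x. u (f (x + v)) \<partial>?L) = (\<integral>\<^sup>+x. u (f x) \<partial>?L)" 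
    if [measurable]: "u \<in> borel_measurable borel" for u v
    using nn_integral_lborel_translate[of "\<lambda>x. u (f x)" v] by (simp add: add.commute)
  \<comment> \<open>The uniqueness proof for Haar measure: the double integral of
    \<open>u (f x) * v (f x + y)\<close> is evaluated in both orders, where the shift of
    \<open>x\<close> by \<open>g y\<close> moves \<open>y\<close> from the argument of
    \<open>v\<close> to that of \<open>u\<close>.\<close>
  have main: "(\<integral>\<^sup>+x. u (f x) \<partial>?L) * (\<integral>\<^sup>+x. v x \<partial>?L) = (\<integral>\<^sup>+x. v (f x) \<partial>?L) * (\<integral>\<^sup>+x. u x \<partial>?L)"
    if [measurable]: "u \<in> borel_measurable borel" "v \<in> borel_measurable borel" for u v
  proof -
    have "(\<integral>\<^sup>+x. u (f x) \<partial>?L) * (\<integral>\<^sup>+x. v x \<partial>?L) = (\<integral>\<^sup>+x. u (f x) * (\<integral>\<^sup>+y. v y \<partial>?L) \<partial>?L)"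
      by (simp add: nn_integral_multc)
    also have "\<dots> = (\<integral>\<^sup>+x. u (f x) * (\<integral>\<^sup>+y. v (f x + y) \<partial>?L) \<partial>?L)"
      by (simp add: nn_integral_lborel_translate)
    also have "\<dots> = (\<integral>\<^sup>+x. (\<integral>\<^sup>+y. u (f x) * v (f x + y) \<partial>?L) \<partial>?L)"
      by (simp add: nn_integral_cmult)
    also have "\<dots> = (\<integral>\<^sup>+y. (\<integral>\<^sup>+x. u (f x) * v (f x + y) \<partial>?L) \<partial>?L)"
      by (rule lborel_pair.Fubini') measurable
    also have "\<dots> = (\<integral>\<^sup>+y. (\<integral>\<^sup>+x. u (f x - y) * v (f x) \<partial>?L) \<partial>?L)"
    proof (rule nn_integral_cong)
      fix y :: 'a
      have "(\<integral>\<^sup>+x. u (f x) * v (f x + y) \<partial>?L) = (\<integral>\<^sup>+x. u (f (x + g y) - y) * v (f (x + g y)) \<partial>?L)"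
        by (simp add: linear_add[OF lin] g)
      also have "\<dots> = (\<integral>\<^sup>+x. u (f x - y) * v (f x) \<partial>?L)"
        by (rule tr[of "\<lambda>z. u (z - y) * v z" "g y"]) measurable
      finally show "(\<integral>\<^sup>+x. u (f x) * v (f x + y) \<partial>?L) = (\<integral>\<^sup>+x. u (f x - y) * v (f x) \<partial>?L)" .
    qed
    also have "\<dots> = (\<integral>\<^sup>+x. (\<integral>\<^sup>+y. u (f x - y) * v (f x) \<partial>?L) \<partial>?L)"
      by (rule lborel_pair.Fubini') measurable
    also have "\<dots> = (\<integral>\<^sup>+x. v (f x) * (\<integral>\<^sup>+y. u (f x + - y) \<partial>?L) \<partial>?L)"
      by (subst nn_integral_cmult[symmetric]) (auto simp: mult.commute)
    also have "\<dots> = (\<integral>\<^sup>+x. v (f x) * (\<integral>\<^sup>+y. u (f x + y) \<partial>?L) \<partial>?L)"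
      by (subst nn_integral_lborel_uminus) auto
    also have "\<dots> = (\<integral>\<^sup>+x. v (f x) \<partial>?L) * (\<integral>\<^sup>+x. u x \<partial>?L)"
      by (simp add: nn_integral_lborel_translate nn_integral_multc)
    finally show ?thesis .
  qed
  \<comment> \<open>The unit ball is invariant under \<open>f\<close> and has finite nonzero
    measure, so with this choice \<open>main\<close> says that the scaling constant of
    \<open>f\<close> is \<open>1\<close>.\<close>
  let ?v = "indicator (ball 0 1) :: 'a \<Rightarrow> ennreal"
  have v: "?v (f x) = ?v x" for x
    by (simp add: indicator_def nf)
  have iv: "(\<integral>\<^sup>+x. ?v x \<partial>?L) = emeasure lborel (ball (0::'a) 1)"
    by simp
  have fin: "(\<integral>\<^sup>+x. ?v x \<partial>?L) \<noteq> top" 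
    unfolding iv using emeasure_lborel_ball_finite[of "0::'a" 1] by (simp add: less_top)
  have "emeasure lborel (ball (0::'a) 1) \<noteq> 0"
    using open_not_negligible[of "ball (0::'a) 1"]
    by (auto simp: negligible_iff_null_sets null_sets_def)
  with iv have nz: "(\<integral>\<^sup>+x. ?v x \<partial>?L) \<noteq> 0" by metis
  show ?thesis
  proof (rule measure_eqI)
    fix A assume "A \<in> sets (distr ?L borel f)"
    then have [measurable]: "A \<in> sets borel" by simp
    let ?I = "\<integral>\<^sup>+x. ?v x \<partial>?L"
    have [measurable]: "?v \<in> borel_measurable borel"
      by (intro borel_measurable_indicator) simp
    have "(\<integral>\<^sup>+x. indicator A (f x) \<partial>?L) * ?I = ?I * (\<integral>\<^sup>+x. indicator A x \<partial>?L)"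
      using main[of "indicator A" ?v] unfolding v by simp
    then have "(\<integral>\<^sup>+x. indicator A (f x) \<partial>?L) = (\<integral>\<^sup>+x. indicator A x \<partial>?L)"
      using fin nz by (metis ennreal_mult_cancel_left mult.commute)
    moreover have "(\<integral>\<^sup>+x. indicator A (f x) \<partial>?L) = (\<integral>\<^sup>+x. indicator A x \<partial>distr ?L borel f)"
      by (rule nn_integral_distr[symmetric]) auto
    ultimately show "emeasure (distr ?L borel f) A = emeasure ?L A"
      by simp
  qed simp
qed

section \<open>Characters and the unit cube\<close>

definition unit_char :: "real \<Rightarrow> complex" where
  "unit_char x = cis (2 * pi * x)"

lemma unit_char_0 [simp]: "unit_char 0 = 1"
  by (simp add: unit_char_def)

lemma unit_char_add: "unit_char (x + y) = unit_char x * unit_char y"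
  by (simp add: unit_char_def cis_mult distrib_left)

lemma unit_char_minus: "unit_char (- x) = cnj (unit_char x)"
  by (simp add: unit_char_def cis_cnj)

lemma unit_char_diff: "unit_char (x - y) = unit_char x * cnj (unit_char y)"
  by (metis unit_char_add unit_char_minus uminus_add_conv_diff add.commute)

lemma norm_unit_char [simp]: "norm (unit_char x) = 1"
  by (simp add: unit_char_def)

lemma unit_char_Ints [simp]: "x \<in> \<int> \<Longrightarrow> unit_char x = 1"
  unfolding unit_char_def
  by (auto simp: complex_eq_iff cos_one_2pi_int elim!: Ints_cases)

lemma continuous_on_unit_char [continuous_intros]:
  "continuous_on A f \<Longrightarrow> continuous_on A (\<lambda>x. unit_char (f x))"
  unfolding unit_char_def by (intro continuous_intros)

lemma borel_measurable_unit_char [measurable]: "unit_char \<in> borel_measurable borel"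
  by (intro borel_measurable_continuous_onI continuous_intros)

text \<open>Parametrising integer vectors by functions turns sums over \<open>\<int>^n\<close> into
  sums over a product set, which factor into one-dimensional sums.\<close>

definition vec_of_int :: "('n \<Rightarrow> int) \<Rightarrow> real ^ 'n" where
  "vec_of_int g = (\<chi> i. of_int (g i))"

lemma vec_of_int_nth [simp]: "vec_of_int g $ i = of_int (g i)"
  by (simp add: vec_of_int_def)

lemma inj_vec_of_int: "inj vec_of_int"
  by (auto simp: inj_def vec_eq_iff)

lemma integer_vectors_eq: "integer_vectors = range vec_of_int"
proof -
  have "x \<in> range vec_of_int" if "x \<in> integer_vectors" for x :: "real ^ 'a"
    using that
    by (intro image_eqI[where x="\<lambda>i. \<lfloor>x $ i\<rfloor>"])
      (auto simp: integer_vectors_def vec_eq_iff elim!: Ints_cases)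
  then show ?thesis
    by (auto simp: integer_vectors_def)
qed

lemma vec_of_int_in_integer_vectors [simp]: "vec_of_int g \<in> integer_vectors"
  by (simp add: integer_vectors_eq)

lemma integer_vectors_add: "x \<in> integer_vectors \<Longrightarrow> y \<in> integer_vectors \<Longrightarrow> x + y \<in> integer_vectors"
  by (auto simp: integer_vectors_def)

lemma integer_vectors_diff: "x \<in> integer_vectors \<Longrightarrow> y \<in> integer_vectors \<Longrightarrow> x - y \<in> integer_vectors"
  by (auto simp: integer_vectors_def)

lemma integer_vectors_uminus: "x \<in> integer_vectors \<Longrightarrow> - x \<in> integer_vectors"
  by (auto simp: integer_vectors_def)

lemma zero_in_integer_vectors [simp]: "0 \<in> integer_vectors"
  by (auto simp: integer_vectors_def)

lemma inner_integer_vectors: "x \<in> integer_vectors \<Longrightarrow> y \<in> integer_vectors \<Longrightarrow> x \<bullet> y \<in> \<int>"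
  by (auto simp: integer_vectors_def inner_vec_def)

lemma countable_integer_vectors: "countable (integer_vectors :: (real ^ 'n) set)"
proof -
  have "countable (Pi\<^sub>E (UNIV :: 'n set) (\<lambda>_. UNIV :: int set))"
    by (intro countable_PiE) auto
  then show ?thesis
    by (simp add: integer_vectors_eq PiE_UNIV_domain)
qed

lemma infinite_integer_vectors: "infinite (integer_vectors :: (real ^ 'n) set)"
proof -
  have "inj (\<lambda>k::int. vec_of_int (\<lambda>_::'n. k))"
    by (auto simp: inj_def vec_eq_iff)
  moreover have "range (\<lambda>k::int. vec_of_int (\<lambda>_::'n. k)) \<subseteq> integer_vectors"
    by auto
  ultimately show ?thesis
    by (meson finite_imageD finite_subset infinite_UNIV_int)
qed

text \<open>Half-open, so that the integer translates tile the space without overlap; centred, so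
  that the point \<open>0\<close>, where the Fejer kernel concentrates, is interior.\<close>

definition half_cube :: "(real ^ 'n) set" where
  "half_cube = {x. \<forall>i. - 1 / 2 \<le> x $ i \<and> x $ i < 1 / 2}"

lemma sets_half_cube [measurable]: "half_cube \<in> sets borel"
  unfolding half_cube_def by measurable

section \<open>Integration over the unit cube and its translates\<close>

lemma integral_lborel_prod:
  fixes f :: "'a::euclidean_space \<Rightarrow> real \<Rightarrow> 'b::{real_normed_field,banach,second_countable_topology}"
  assumes "\<And>b. b \<in> Basis \<Longrightarrow> integrable lborel (f b)"
  shows "(LINT x|lborel. (\<Prod>b\<in>Basis. f b (x \<bullet> b))) = (\<Prod>b\<in>Basis. LINT y|lborel. f b y)"
    and "integrable lborel (\<lambda>x. \<Prod>b\<in>Basis. f b (x \<bullet> b))"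
proof -
  interpret product_sigma_finite "\<lambda>_::'a. lborel :: real measure" ..
  have [measurable]: "f b \<in> borel_measurable borel" if "b \<in> Basis" for b
    using assms[OF that] by simp
  have *: "(\<Prod>b\<in>Basis. f b ((\<Sum>b\<in>Basis. x b *\<^sub>R b) \<bullet> b)) = (\<Prod>b\<in>Basis. f b (x b))" for x
    by (intro prod.cong) simp_all
  have m: "(\<lambda>x. \<Prod>b\<in>Basis. f b (x \<bullet> b)) \<in> borel_measurable borel"
    by measurable
  show "(LINT x|lborel. (\<Prod>b\<in>Basis. f b (x \<bullet> b))) = (\<Prod>b\<in>Basis. LINT y|lborel. f b y)"
    by (subst lborel_eq, subst integral_distr)
      (use assms m in \<open>simp_all add: * product_integral_prod\<close>)
  show "integrable lborel (\<lambda>x. \<Prod>b\<in>Basis. f b (x \<bullet> b))"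
    by (subst lborel_eq, subst integrable_distr_eq)
      (use assms m in \<open>simp_all add: * product_integrable_prod\<close>)
qed

lemma prod_Basis_vec: "(\<Prod>b\<in>(Basis :: (real ^ 'n) set). F b) = (\<Prod>i\<in>UNIV. F (axis i 1))"
proof -
  have "(Basis :: (real ^ 'n) set) = range (\<lambda>i. axis i 1)"
    by (auto simp: Basis_vec_def)
  moreover have "inj (\<lambda>i::'n. axis i (1::real))"
    by (auto simp: inj_def axis_eq_axis)
  ultimately show ?thesis
    using prod.reindex[of "\<lambda>i. axis i 1" UNIV F] by (simp only: o_def)
qed

lemma has_integral_unit_char:
  assumes "c \<in> \<int>"
  shows "has_bochner_integral lborel (\<lambda>y. indicator {- 1 / 2..<1 / 2} y *\<^sub>R unit_char (c * y))
    (if c = 0 then 1 else 0)"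
proof -
  have "has_bochner_integral lborel (\<lambda>y. indicator {- 1 / 2..1 / 2} y *\<^sub>R unit_char (c * y))
    (if c = 0 then 1 else 0)"
  proof (cases "c = 0")
    case True
    have "has_bochner_integral lborel (\<lambda>x. indicator {- 1 / 2..1 / 2 :: real} x *\<^sub>R (1 :: complex))
      (complex_of_real (1 / 2) - complex_of_real (- 1 / 2))"
      by (rule has_bochner_integral_FTC_Icc) (auto intro!: derivative_eq_intros)
    with True show ?thesis by simp
  next
    case False
    let ?F = "\<lambda>y. unit_char (c * y) / (2 * pi * \<i> * c)"
    have "has_bochner_integral lborel (\<lambda>y. indicator {- 1 / 2..1 / 2} y *\<^sub>R unit_char (c * y))
       (?F (1 / 2) - ?F (- 1 / 2))"
    proof (rule has_bochner_integral_FTC_Icc)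
      show "(?F has_vector_derivative unit_char (c * y)) (at y within {- 1 / 2..1 / 2})" for y
      proof -
        have "((\<lambda>y. exp (\<i> * of_real (2 * pi * (c * y))) / (2 * pi * \<i> * c)) has_vector_derivative
          exp (\<i> * of_real (2 * pi * (c * y)))) (at y within {- 1 / 2..1 / 2})"
          using False
          by (auto intro!: derivative_eq_intros has_vector_derivative_real_field simp: field_simps)
        then show ?thesis by (simp add: unit_char_def cis_conv_exp)
      qed
    qed (auto intro!: continuous_intros)
    moreover have "unit_char (c * (1 / 2)) = unit_char (c * (- 1 / 2))"
      using unit_char_add[of c "c * (- 1 / 2)"] assms by (simp add: field_simps)
    ultimately show ?thesis using False by simp
  qed
  moreover have "AE y in lborel. indicator {- 1 / 2..<1 / 2} y *\<^sub>R unit_char (c * y)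
    = indicator {- 1 / 2..1 / 2 :: real} y *\<^sub>R unit_char (c * y)"
    using AE_lborel_singleton[of "1 / 2 :: real"]
    by eventually_elim (auto simp: indicator_def)
  moreover have "(\<lambda>y. indicator {- 1 / 2..<1 / 2 :: real} y *\<^sub>R unit_char (c * y)) \<in> borel_measurable lborel"
    "(\<lambda>y. indicator {- 1 / 2..1 / 2 :: real} y *\<^sub>R unit_char (c * y)) \<in> borel_measurable lborel"
    by measurable
  ultimately show ?thesis
    using has_bochner_integral_cong_AE by blast
qed

lemma half_cube_integral_unit_char:
  fixes k :: "real ^ 'n"
  assumes "k \<in> integer_vectors"
  shows "(LINT x:half_cube|lborel. unit_char (k \<bullet> x)) = (if k = 0 then 1 else 0)"
    and "set_integrable lborel half_cube (\<lambda>x. unit_char (k \<bullet> x))"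
proof -
  define f where "f b y = indicator {- 1 / 2..<1 / 2} y *\<^sub>R unit_char ((k \<bullet> b) * y)" for b :: "real ^ 'n" and y :: real
  have hb: "has_bochner_integral lborel (f b) (if k \<bullet> b = 0 then 1 else 0)" if "b \<in> Basis" for b
    unfolding f_def using that assms
    by (intro has_integral_unit_char) (auto simp: Basis_vec_def integer_vectors_def inner_axis)
  have int: "integrable lborel (f b)" "(LINT y|lborel. f b y) = (if k \<bullet> b = 0 then 1 else 0)" if "b \<in> Basis" for b
    using hb[OF that] by (auto simp: has_bochner_integral_iff)
  have f_axis: "f (axis i 1) y = indicator {- 1 / 2..<1 / 2} y *\<^sub>R unit_char (k $ i * y)" for i y
    by (simp add: f_def inner_axis)
  have "unit_char (\<Sum>i\<in>A. g i) = (\<Prod>i\<in>A. unit_char (g i))" if "finite A" for A :: "'n set" and g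
    using that by (induction A) (auto simp: unit_char_add)
  then have "(\<Prod>i\<in>UNIV. f (axis i 1) (x $ i)) = indicator half_cube x *\<^sub>R unit_char (k \<bullet> x)" for x
    by (auto simp: f_axis half_cube_def inner_vec_def indicator_def not_le not_less)
  then have eq: "(\<lambda>x. \<Prod>b\<in>Basis. f b (x \<bullet> b)) = (\<lambda>x. indicator half_cube x *\<^sub>R unit_char (k \<bullet> x))"
    by (simp add: prod_Basis_vec inner_axis)
  have "(\<Prod>b\<in>Basis. LINT y|lborel. f b y) = (\<Prod>i\<in>UNIV. if k $ i = 0 then 1 else 0)"
    by (simp add: int(2) prod_Basis_vec inner_axis)
  also have "\<dots> = (if k = 0 then 1 else 0)"
    by (auto simp: vec_eq_iff)
  finally show "(LINT x:half_cube|lborel. unit_char (k \<bullet> x)) = (if k = 0 then 1 else 0)"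
    using integral_lborel_prod(1)[of f, OF int(1)] by (simp add: set_lebesgue_integral_def eq)
  show "set_integrable lborel half_cube (\<lambda>x. unit_char (k \<bullet> x))"
    using integral_lborel_prod(2)[of f, OF int(1)] by (simp add: set_integrable_def eq)
qed

lemma integral_half_cube_tiling:
  fixes f :: "real ^ 'n \<Rightarrow> complex" and m :: "nat \<Rightarrow> real ^ 'n"
  assumes m: "bij_betw m UNIV integer_vectors" and f: "integrable lborel f"
  shows "(LINT x|lborel. f x) = (\<Sum>i. LINT x:half_cube|lborel. f (m i + x))"
proof -
  let ?A = "\<lambda>i. {x. x - m i \<in> half_cube}"
  have [measurable]: "f \<in> borel_measurable borel" using f by simp
  have meas: "?A i \<in> sets borel" for i by measurable
  have disj: "?A i \<inter> ?A j = {}" if "i \<noteq> j" for i j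
  proof (rule ccontr)
    assume "?A i \<inter> ?A j \<noteq> {}"
    then obtain x where x: "x - m i \<in> half_cube" "x - m j \<in> half_cube" by auto
    have "m i $ l = m j $ l" for l
    proof -
      have "m i $ l \<in> \<int>" "m j $ l \<in> \<int>"
        using m by (auto simp: bij_betw_def integer_vectors_def)
      then obtain a b where ab: "m i $ l = of_int a" "m j $ l = of_int b"
        by (auto elim!: Ints_cases)
      moreover have "\<bar>m i $ l - m j $ l\<bar> < 1"
        using x unfolding half_cube_def by (simp add: abs_if) (smt (verit) field_sum_of_halves)
      ultimately have "\<bar>of_int (a - b)\<bar> < (1 :: real)" by simp
      then have "a = b" by linarith
      with ab show ?thesis by simp
    qed
    then have "m i = m j" by (simp add: vec_eq_iff)
    with m that show False by (auto simp: bij_betw_def inj_def)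
  qed
  have cover: "(\<Union>i. ?A i) = UNIV"
  proof -
    have "\<exists>i. x \<in> ?A i" for x
    proof -
      \<comment> \<open>Rounding each coordinate to the nearest integer; ties go up, as the
        half-open cube demands.\<close>
      have "vec_of_int (\<lambda>i. \<lfloor>x $ i + 1 / 2\<rfloor>) \<in> range m"
        using m by (simp add: bij_betw_def)
      then obtain i where "m i = vec_of_int (\<lambda>i. \<lfloor>x $ i + 1 / 2\<rfloor>)" by auto
      then have "x \<in> ?A i" by (auto simp: half_cube_def) linarith+
      then show ?thesis by blast
    qed
    then show ?thesis by auto
  qed
  have piece: "(LINT x:?A i|lborel. f x) = (LINT x:half_cube|lborel. f (m i + x))" for i
  proof -
    have "(LINT x:?A i|lborel. f x) = (LINT x|distr lborel borel ((+) (m i)). indicator (?A i) x *\<^sub>R f x)"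
      by (simp add: lborel_distr_plus set_lebesgue_integral_def)
    also have "\<dots> = (LINT x|lborel. indicator (?A i) (m i + x) *\<^sub>R f (m i + x))"
      by (subst integral_distr) auto
    finally show ?thesis by (simp add: set_lebesgue_integral_def indicator_def)
  qed
  have "(LINT x|lborel. f x) = (LINT x:(\<Union>i. ?A i)|lborel. f x)"
    unfolding cover by (simp add: set_lebesgue_integral_def)
  also have "\<dots> = (\<Sum>i. LINT x:?A i|lborel. f x)"
    by (rule lebesgue_integral_countable_add)
      (use meas disj f in \<open>auto simp: cover set_integrable_def\<close>)
  finally show ?thesis by (simp only: piece)
qed

section \<open>The Fejer kernel\<close>

definition int_box :: "nat \<Rightarrow> (real ^ 'n) set" where
  "int_box N = vec_of_int ` (Pi\<^sub>E UNIV (\<lambda>_. {0..<int N}))"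

text \<open>The coefficient of the character \<open>k\<close> in the squared modulus of the
  character sum over the box, normalised to \<open>1\<close> at \<open>k = 0\<close>. Counting pairs
  by their difference makes its nonnegativity evident.\<close>

definition fejer_coeff :: "nat \<Rightarrow> real ^ 'n \<Rightarrow> real" where
  "fejer_coeff N k = real (card {p \<in> int_box N \<times> int_box N. fst p - snd p = k}) / real (N ^ CARD('n))"

text \<open>The Fejer mean of the family \<open>F\<close>, kept as a sum over pairs of box points so
  that integrals can be exchanged with it termwise.\<close>

definition fejer_sum :: "nat \<Rightarrow> (real ^ 'n \<Rightarrow> complex) \<Rightarrow> complex" where
  "fejer_sum N F = (\<Sum>p\<in>int_box N \<times> int_box N. F (fst p - snd p)) / of_nat (N ^ CARD('n))"

definition fejer_kernel :: "nat \<Rightarrow> real ^ 'n \<Rightarrow> real" where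
  "fejer_kernel N x = (cmod (\<Sum>j\<in>int_box N. unit_char (j \<bullet> x)))\<^sup>2 / real (N ^ CARD('n))"

lemma vec_of_int_in_int_box: "vec_of_int g \<in> int_box N \<longleftrightarrow> (\<forall>i. 0 \<le> g i \<and> g i < int N)"
  by (auto simp: int_box_def inj_image_mem_iff[OF inj_vec_of_int] PiE_iff)

lemma finite_int_box [simp]: "finite (int_box N)"
  unfolding int_box_def by (intro finite_imageI finite_PiE) auto

lemma int_box_integer_vectors: "x \<in> int_box N \<Longrightarrow> x \<in> integer_vectors"
  by (auto simp: int_box_def)

lemma fejer_coeff_nonneg [simp]: "0 \<le> fejer_coeff N k"
  by (simp add: fejer_coeff_def)

text \<open>A pair with difference \<open>g\<close> is determined by its second point
  \<open>a\<close>. That \<open>a\<close> and \<open>a + g\<close> both lie in the box is an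
  interval condition in each coordinate separately, with \<open>N - \<bar>g i\<bar>\<close>
  solutions, cut off at zero by \<open>nat\<close>. The result is a product of triangle
  weights.\<close>

lemma fejer_coeff_vec_of_int:
  "fejer_coeff N (vec_of_int g :: real ^ 'n) = (\<Prod>i\<in>UNIV. real (nat (int N - \<bar>g i\<bar>)) / real N)"
proof -
  let ?S = "{p \<in> int_box N \<times> int_box N. fst p - snd p = (vec_of_int g :: real ^ 'n)}"
  let ?I = "\<lambda>i. {max 0 (- g i)..<min (int N) (int N - g i)}"
  have "bij_betw (\<lambda>a. (vec_of_int (\<lambda>i. a i + g i), vec_of_int a)) (Pi\<^sub>E UNIV ?I) ?S"
    unfolding bij_betw_def
  proof
    show "inj_on (\<lambda>a. (vec_of_int (\<lambda>i. a i + g i) :: real ^ 'n, vec_of_int a :: real ^ 'n)) (Pi\<^sub>E UNIV ?I)"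
      using inj_vec_of_int by (auto simp: inj_on_def)
    show "(\<lambda>a. (vec_of_int (\<lambda>i. a i + g i), vec_of_int a)) ` (Pi\<^sub>E UNIV ?I) = ?S"
    proof (intro equalityI subsetI)
      fix p assume "p \<in> (\<lambda>a. (vec_of_int (\<lambda>i. a i + g i) :: real ^ 'n, vec_of_int a :: real ^ 'n)) ` (Pi\<^sub>E UNIV ?I)"
      then obtain a where p: "p = (vec_of_int (\<lambda>i. a i + g i), vec_of_int a)" and a: "a \<in> Pi\<^sub>E UNIV ?I"
        by blast
      from a have "a i \<in> ?I i" for i by (simp add: PiE_iff)
      then have "max 0 (- g i) \<le> a i" "a i < min (int N) (int N - g i)" for i
        by (simp_all only: atLeastLessThan_iff)
      then have "0 \<le> a i \<and> a i < int N \<and> 0 \<le> a i + g i \<and> a i + g i < int N" for i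
        by (smt (verit, best))
      then show "p \<in> ?S"
        by (simp add: p vec_of_int_in_int_box vec_eq_iff)
    next
      fix p assume "p \<in> ?S"
      moreover from this obtain a b where p: "p = (vec_of_int b, vec_of_int a)"
        by (cases p) (auto simp: int_box_def)
      ultimately have ab: "\<And>i. a i \<in> {0..<int N}" "\<And>i. b i \<in> {0..<int N}"
        and "vec_of_int b - vec_of_int a = (vec_of_int g :: real ^ 'n)"
        by (simp_all add: vec_of_int_in_int_box)
      then have "real_of_int (b i) = of_int (a i + g i)" for i
        by (auto simp: vec_eq_iff algebra_simps)
      then have "b i = a i + g i" for i
        by (simp only: of_int_eq_iff)
      then have b: "b = (\<lambda>i. a i + g i)" by auto
      have "a i \<in> ?I i" for i using ab[of i] by (auto simp: b)
      then show "p \<in> (\<lambda>a. (vec_of_int (\<lambda>i. a i + g i), vec_of_int a)) ` (Pi\<^sub>E UNIV ?I)"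
        unfolding p b by (intro imageI) auto
    qed
  qed
  then have "card ?S = card (Pi\<^sub>E UNIV ?I)"
    by (simp add: bij_betw_same_card)
  also have "\<dots> = (\<Prod>i\<in>UNIV. nat (int N - \<bar>g i\<bar>))"
    by (subst card_PiE) (auto intro!: prod.cong)
  finally show ?thesis
    by (simp add: fejer_coeff_def prod_dividef)
qed

lemma fejer_coeff_le_1: "fejer_coeff N k \<le> 1"
proof (cases "k \<in> integer_vectors")
  case True
  then obtain g where k: "k = vec_of_int g" by (auto simp: integer_vectors_eq)
  have "real (nat (int N - \<bar>g i\<bar>)) / real N \<le> 1" for i
    by (cases "N = 0") (auto simp: divide_simps)
  then show ?thesis
    unfolding k fejer_coeff_vec_of_int by (intro prod_le_1) auto
next
  case False
  have "{p \<in> int_box N \<times> int_box N. fst p - snd p = k} = {}"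
    using False by (auto dest: int_box_integer_vectors intro: integer_vectors_diff)
  then show ?thesis by (simp only: fejer_coeff_def) simp
qed

lemma fejer_coeff_tendsto:
  assumes "k \<in> integer_vectors"
  shows "(\<lambda>N. fejer_coeff N k) \<longlonglongrightarrow> 1"
proof -
  obtain g where k: "k = vec_of_int g" using assms by (auto simp: integer_vectors_eq)
  have "(\<lambda>N. real (nat (int N - \<bar>a\<bar>)) / real N) \<longlonglongrightarrow> 1" for a :: int
  proof (rule Lim_transform_eventually)
    show "(\<lambda>N. 1 - of_int \<bar>a\<bar> / real N) \<longlonglongrightarrow> 1"
      using tendsto_diff[OF tendsto_const lim_const_over_n[of "of_int \<bar>a\<bar> :: real"], of "1 :: real"]
      by simp
    show "\<forall>\<^sub>F N in sequentially. 1 - of_int \<bar>a\<bar> / real N = real (nat (int N - \<bar>a\<bar>)) / real N"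
      using eventually_ge_at_top[of "nat \<bar>a\<bar> + 1"]
    proof eventually_elim
      case (elim N)
      then have "int N - \<bar>a\<bar> \<ge> 0" "N > 0" by auto
      then show ?case by (simp add: field_simps)
    qed
  qed
  then have "(\<lambda>N. \<Prod>i\<in>(UNIV :: 'a set). real (nat (int N - \<bar>g i\<bar>)) / real N) \<longlonglongrightarrow> (\<Prod>i\<in>(UNIV :: 'a set). 1)"
    by (intro tendsto_prod)
  then show ?thesis
    unfolding k fejer_coeff_vec_of_int by simp
qed

lemma fejer_coeff_0: "N > 0 \<Longrightarrow> fejer_coeff N (0 :: real ^ 'n) = 1"
  using fejer_coeff_vec_of_int[of N "\<lambda>_::'n. 0"] by (simp add: vec_of_int_def zero_vec_def)

text \<open>The pairs are grouped by their difference. \<open>D\<close> may exceed the set of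
  differences, since the extra coefficients vanish; this allows chosen points to be adjoined before
  they are singled out.\<close>

lemma fejer_sum_eq:
  assumes "finite D" "(\<lambda>p. fst p - snd p) ` (int_box N \<times> int_box N) \<subseteq> D"
  shows "fejer_sum N F = (\<Sum>k\<in>D. fejer_coeff N k *\<^sub>R F k)"
proof -
  let ?B = "int_box N \<times> int_box N"
  have "(\<Sum>p\<in>?B. F (fst p - snd p)) = (\<Sum>k\<in>D. \<Sum>p\<in>{p\<in>?B. fst p - snd p = k}. F (fst p - snd p))"
    by (rule sum.group[symmetric]) (use assms in auto)
  also have "\<dots> = (\<Sum>k\<in>D. of_nat (card {p\<in>?B. fst p - snd p = k}) * F k)"
    by (intro sum.cong refl) (simp add: sum_constant)
  finally show ?thesis
    by (simp add: fejer_sum_def fejer_coeff_def scaleR_conv_of_real sum_divide_distrib)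
qed

lemma fejer_sum_indicator:
  assumes "r \<in> integer_vectors"
  shows "fejer_sum N (\<lambda>k. if k = r then c else 0) = fejer_coeff N r *\<^sub>R c"
proof -
  let ?D = "insert r ((\<lambda>p. fst p - snd p) ` (int_box N \<times> int_box N))"
  have "fejer_sum N (\<lambda>k. if k = r then c else 0) = (\<Sum>k\<in>?D. fejer_coeff N k *\<^sub>R (if k = r then c else 0))"
    by (rule fejer_sum_eq) auto
  also have "\<dots> = (\<Sum>k\<in>{r}. fejer_coeff N k *\<^sub>R (if k = r then c else 0))"
    by (rule sum.mono_neutral_right) auto
  finally show ?thesis by simp
qed

lemma fejer_kernel_nonneg [simp]: "0 \<le> fejer_kernel N x"
  by (simp add: fejer_kernel_def)

lemma fejer_kernel_eq: "complex_of_real (fejer_kernel N x) = fejer_sum N (\<lambda>k. unit_char (k \<bullet> x))"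
proof -
  let ?S = "\<Sum>j\<in>int_box N. unit_char (j \<bullet> x)"
  have "complex_of_real ((cmod ?S)\<^sup>2) = ?S * cnj ?S"
    by (rule complex_norm_square)
  also have "\<dots> = (\<Sum>p\<in>int_box N \<times> int_box N. unit_char ((fst p - snd p) \<bullet> x))"
    by (simp add: sum_product sum.cartesian_product inner_diff_left unit_char_diff case_prod_unfold)
  finally show ?thesis
    by (simp add: fejer_kernel_def fejer_sum_def)
qed

lemma fejer_kernel_periodic:
  assumes "m \<in> integer_vectors"
  shows "fejer_kernel N (m + x) = fejer_kernel N x"
proof -
  have "unit_char (j \<bullet> (m + x)) = unit_char (j \<bullet> x)" if "j \<in> int_box N" for j
    using inner_integer_vectors[OF int_box_integer_vectors[OF that] assms]
    by (simp add: inner_add_right unit_char_add)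
  then show ?thesis by (simp add: fejer_kernel_def)
qed

lemma continuous_on_fejer_kernel [continuous_intros]: "continuous_on A (fejer_kernel N)"
  unfolding fejer_kernel_def divide_inverse by (intro continuous_intros)

lemma borel_measurable_fejer_kernel [measurable]: "fejer_kernel N \<in> borel_measurable borel"
  by (intro borel_measurable_continuous_onI continuous_intros)

text \<open>By orthogonality of characters on the cube only the pairs with difference
  \<open>- r\<close> survive.\<close>

lemma fejer_kernel_integral_unit_char:
  fixes r :: "real ^ 'n"
  assumes r: "r \<in> integer_vectors"
  shows "set_integrable lborel half_cube (\<lambda>x. of_real (fejer_kernel N x) * unit_char (r \<bullet> x))"
    and "(LINT x:half_cube|lborel. of_real (fejer_kernel N x) * unit_char (r \<bullet> x)) = of_real (fejer_coeff N (- r))"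
proof -
  let ?B = "int_box N \<times> int_box N :: ((real ^ 'n) \<times> (real ^ 'n)) set"
  let ?c = "\<lambda>p x. unit_char ((fst p - snd p + r) \<bullet> x)"
  have eq: "of_real (fejer_kernel N x) * unit_char (r \<bullet> x) = (\<Sum>p\<in>?B. ?c p x) / of_nat (N ^ CARD('n))" for x
    by (simp add: fejer_kernel_eq fejer_sum_def unit_char_add inner_add_left sum_distrib_right)
  have Z: "fst p - snd p + r \<in> integer_vectors" if "p \<in> ?B" for p
    using that r by (auto intro!: integer_vectors_add integer_vectors_diff dest: int_box_integer_vectors)
  have si: "set_integrable lborel half_cube (?c p)" if "p \<in> ?B" for p
    using half_cube_integral_unit_char(2)[OF Z[OF that]] .
  have si': "set_integrable lborel half_cube (\<lambda>x. \<Sum>p\<in>?B. ?c p x)"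
    using si unfolding set_integrable_def scaleR_sum_right
    by (intro Bochner_Integration.integrable_sum) auto
  then show "set_integrable lborel half_cube (\<lambda>x. of_real (fejer_kernel N x) * unit_char (r \<bullet> x))"
    unfolding eq by (rule set_integrable_divide)
  have "(LINT x:half_cube|lborel. of_real (fejer_kernel N x) * unit_char (r \<bullet> x))
      = (LINT x:half_cube|lborel. (\<Sum>p\<in>?B. ?c p x)) / of_nat (N ^ CARD('n))"
    unfolding eq by (rule set_integral_divide_zero)
  also have "(LINT x:half_cube|lborel. (\<Sum>p\<in>?B. ?c p x)) = (\<Sum>p\<in>?B. LINT x:half_cube|lborel. ?c p x)"
    unfolding set_lebesgue_integral_def scaleR_sum_right
    by (rule Bochner_Integration.integral_sum) (use si in \<open>auto simp: set_integrable_def\<close>)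
  also have "\<dots> = (\<Sum>p\<in>?B. if fst p - snd p = - r then 1 else 0)"
    by (intro sum.cong refl) (subst half_cube_integral_unit_char(1)[OF Z], auto simp: eq_neg_iff_add_eq_0)
  also have "\<dots> / of_nat (N ^ CARD('n)) = fejer_sum N (\<lambda>k. if k = - r then 1 else 0)"
    by (simp add: fejer_sum_def)
  also have "\<dots> = of_real (fejer_coeff N (- r))"
    using fejer_sum_indicator[OF integer_vectors_uminus[OF r]] by (simp add: scaleR_conv_of_real)
  finally show "(LINT x:half_cube|lborel. of_real (fejer_kernel N x) * unit_char (r \<bullet> x)) = of_real (fejer_coeff N (- r))" .
qed

lemma fejer_kernel_integral:
  shows "set_integrable lborel half_cube (fejer_kernel N)"
    and "N > 0 \<Longrightarrow> (LINT x:half_cube|lborel. fejer_kernel N x) = 1"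
proof -
  note * = fejer_kernel_integral_unit_char[OF zero_in_integer_vectors, of N, simplified]
  show "set_integrable lborel half_cube (fejer_kernel N)"
    using *(1) unfolding set_integrable_def by (auto dest!: integrable_Re)
  show "(LINT x:half_cube|lborel. fejer_kernel N x) = 1" if "N > 0"
    using *(2) that
    by (simp add: set_lebesgue_integral_def scaleR_conv_of_real fejer_coeff_0 flip: of_real_mult)
qed

text \<open>The test functions for Korovkin's argument: \<open>1 - cos (2 * pi * x $ i)\<close>
  vanishes at \<open>0\<close> and is bounded below where \<open>x $ i\<close> is away from
  \<open>0\<close>, so this integral controls the mass of the kernel there, and it tends to
  \<open>0\<close>.\<close>

lemma fejer_kernel_integral_cos:
  fixes i :: "'n::finite"
  assumes "N > 0"
  shows "set_integrable lborel half_cube (\<lambda>x::real ^ 'n. fejer_kernel N x * (1 - cos (2 * pi * x $ i)))"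
    and "(LINT x:half_cube|lborel. fejer_kernel N x * (1 - cos (2 * pi * x $ i))) = 1 - fejer_coeff N (- axis i 1 :: real ^ 'n)"
proof -
  have a: "axis i 1 \<in> (integer_vectors :: (real ^ 'n) set)"
    by (auto simp: integer_vectors_def axis_def)
  note * = fejer_kernel_integral_unit_char[OF a, of N]
  have R: "fejer_kernel N x * cos (2 * pi * x $ i) = Re (of_real (fejer_kernel N x) * unit_char (axis i 1 \<bullet> x))" for x :: "real ^ 'n"
    by (simp add: unit_char_def inner_axis inner_commute)
  have si: "set_integrable lborel half_cube (\<lambda>x::real ^ 'n. fejer_kernel N x * cos (2 * pi * x $ i))"
    unfolding R using *(1) by (auto simp: set_integrable_def dest!: integrable_Re)
  show "set_integrable lborel half_cube (\<lambda>x::real ^ 'n. fejer_kernel N x * (1 - cos (2 * pi * x $ i)))"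
    unfolding right_diff_distrib using si fejer_kernel_integral(1)[of N] by (auto intro: set_integral_diff)
  have "(LINT x:half_cube|lborel. fejer_kernel N x * cos (2 * pi * x $ i)) =
    Re (LINT x:half_cube|lborel. of_real (fejer_kernel N x) * unit_char (axis i 1 \<bullet> x))"
    unfolding R using *(1) unfolding set_integrable_def set_lebesgue_integral_def
    by (subst integral_Re[symmetric]) auto
  then show "(LINT x:half_cube|lborel. fejer_kernel N x * (1 - cos (2 * pi * x $ i))) = 1 - fejer_coeff N (- axis i 1 :: real ^ 'n)"
    unfolding right_diff_distrib
    by (subst set_integral_diff) (use si fejer_kernel_integral[of N] assms *(2) in auto)
qed

lemma norm_integral_le:
  fixes f :: "'a \<Rightarrow> 'b::{banach, second_countable_topology}"
  assumes "integrable M f" "integrable M g" "\<And>x. norm (f x) \<le> g x"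
  shows "norm (integral\<^sup>L M f) \<le> integral\<^sup>L M g"
  using order_trans[OF integral_norm_bound integral_mono[OF integrable_norm]] assms by blast

text \<open>
  Korovkin's argument: concentration of the kernel at \<open>0\<close> follows from that of its Fourier
  coefficients at the unit vectors.
\<close>

lemma fejer_kernel_tendsto:
  fixes \<phi> :: "real ^ 'n \<Rightarrow> complex"
  assumes cont: "continuous_on UNIV \<phi>" and bound: "\<And>x. x \<in> half_cube \<Longrightarrow> norm (\<phi> x - \<phi> 0) \<le> M"
  shows "(\<lambda>N. LINT x:half_cube|lborel. of_real (fejer_kernel N x) * \<phi> x) \<longlonglongrightarrow> \<phi> 0"
proof (rule tendstoI)
  fix \<epsilon> :: real assume "\<epsilon> > 0"
  define \<eta> where "\<eta> = \<epsilon> / 2"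
  have \<eta>: "\<eta> > 0" using \<open>\<epsilon> > 0\<close> by (simp add: \<eta>_def)
  have [measurable]: "\<phi> \<in> borel_measurable borel"
    using cont by (rule borel_measurable_continuous_onI)
  have M: "M \<ge> 0" using order_trans[OF norm_ge_zero bound[of 0]] by (simp add: half_cube_def)
  obtain d where d: "d > 0" "\<And>x. norm x < d \<Longrightarrow> norm (\<phi> x - \<phi> 0) < \<eta>"
    using cont[unfolded continuous_on_iff dist_norm, rule_format, of 0 \<eta>] \<eta> by auto
  \<comment> \<open>The bound \<open>1 / 2\<close> keeps \<open>2 * pi * \<delta>\<close> in
    \<open>[0, pi]\<close>, where the cosine decreases. The other bound keeps the sum of
    \<open>CARD('n)\<close> coordinates of size at most \<open>\<delta>\<close>, and hence the norm,
    below \<open>d\<close>.\<close>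
  define \<delta> where "\<delta> = min (1 / 2) (d / (2 * real CARD('n)))"
  have \<delta>: "\<delta> > 0" "\<delta> \<le> 1 / 2" "real CARD('n) * \<delta> < d"
  proof -
    have "real CARD('n) * \<delta> \<le> real CARD('n) * (d / (2 * real CARD('n)))"
      by (intro mult_left_mono) (auto simp: \<delta>_def)
    also have "\<dots> < d" using d by simp
    finally show "real CARD('n) * \<delta> < d" .
  qed (use d in \<open>auto simp: \<delta>_def\<close>)
  define \<kappa> where "\<kappa> = 1 - cos (2 * pi * \<delta>)"
  have "cos (2 * pi * \<delta>) < cos 0"
    using \<delta> by (intro cos_monotone_0_pi) auto
  then have \<kappa>: "\<kappa> > 0" by (simp add: \<kappa>_def)
  let ?K = "fejer_kernel :: nat \<Rightarrow> real ^ 'n \<Rightarrow> real"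
  let ?W = "\<lambda>x::real ^ 'n. \<Sum>i\<in>UNIV. 1 - cos (2 * pi * x $ i)"
  \<comment> \<open>Near \<open>0\<close> the first summand suffices by continuity. Elsewhere some
    coordinate exceeds \<open>\<delta>\<close>, so its term in \<open>?W\<close> is at least
    \<open>\<kappa>\<close> and the second summand is at least \<open>M\<close>.\<close>
  have pointwise: "norm (\<phi> x - \<phi> 0) \<le> \<eta> + M / \<kappa> * ?W x" if x: "x \<in> half_cube" for x
  proof (cases "\<forall>i. \<bar>x $ i\<bar> \<le> \<delta>")
    case True
    have "norm x \<le> (\<Sum>i\<in>UNIV. \<bar>x $ i\<bar>)" by (rule norm_le_l1_cart)
    also have "\<dots> \<le> (\<Sum>i\<in>(UNIV :: 'n set). \<delta>)" using True by (intro sum_mono) auto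
    also have "\<dots> < d" using \<delta>(3) by simp
    finally have "norm (\<phi> x - \<phi> 0) < \<eta>" by (rule d)
    moreover have "0 \<le> M / \<kappa> * ?W x" using M \<kappa> by (intro mult_nonneg_nonneg sum_nonneg) auto
    ultimately show ?thesis by simp
  next
    case False
    then obtain i where i: "\<delta> < \<bar>x $ i\<bar>" by (auto simp: not_le)
    have "\<bar>x $ i\<bar> \<le> 1 / 2" using x unfolding half_cube_def by (simp add: abs_le_iff) (smt (verit) field_sum_of_halves)
    then have "2 * pi * \<bar>x $ i\<bar> \<le> pi" using mult_left_mono[of "\<bar>x $ i\<bar>" "1 / 2" "2 * pi"] by simp
    then have "cos (2 * pi * \<bar>x $ i\<bar>) \<le> cos (2 * pi * \<delta>)"
      using i \<delta> by (intro cos_monotone_0_pi_le) auto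
    also have "cos (2 * pi * \<bar>x $ i\<bar>) = cos (2 * pi * x $ i)"
      by (cases "x $ i \<ge> 0") (auto simp: abs_if)
    finally have "\<kappa> \<le> 1 - cos (2 * pi * x $ i)" by (simp add: \<kappa>_def)
    also have "\<dots> \<le> ?W x" by (rule member_le_sum) auto
    finally have "M \<le> M / \<kappa> * ?W x"
      using M \<kappa> mult_left_mono[of \<kappa> "?W x" "M / \<kappa>"] by simp
    with bound[OF x] \<eta> show ?thesis by linarith
  qed
  have est: "dist (LINT x:half_cube|lborel. of_real (?K N x) * \<phi> x) (\<phi> 0)
      \<le> \<eta> + M / \<kappa> * (\<Sum>i\<in>UNIV. 1 - fejer_coeff N (- axis i 1 :: real ^ 'n))" if N: "N > 0" for N
  proof -
    have intK: "set_integrable lborel half_cube (?K N)" "(LINT x:half_cube|lborel. ?K N x) = 1"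
      using N by (simp_all add: fejer_kernel_integral)
    have intC: "set_integrable lborel half_cube (\<lambda>x. ?K N x * (1 - cos (2 * pi * x $ i)))"
      "(LINT x:half_cube|lborel. ?K N x * (1 - cos (2 * pi * x $ i))) = 1 - fejer_coeff N (- axis i 1 :: real ^ 'n)" for i
      using N by (simp_all add: fejer_kernel_integral_cos)
    have intR: "set_integrable lborel half_cube (\<lambda>x. \<eta> * ?K N x + M / \<kappa> * (\<Sum>i\<in>UNIV. ?K N x * (1 - cos (2 * pi * x $ i))))"
    proof -
      have "set_integrable lborel half_cube (\<lambda>x. \<Sum>i\<in>UNIV. ?K N x * (1 - cos (2 * pi * x $ i)))"
        using intC(1) unfolding set_integrable_def scaleR_sum_right
        by (intro Bochner_Integration.integrable_sum) auto
      then show ?thesis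
        using intK(1) by (intro set_integral_add set_integrable_mult_right) auto
    qed
    have le: "norm (of_real (?K N x) * (\<phi> x - \<phi> 0)) \<le> \<eta> * ?K N x + M / \<kappa> * (\<Sum>i\<in>UNIV. ?K N x * (1 - cos (2 * pi * x $ i)))"
      if "x \<in> half_cube" for x
    proof -
      have "norm (of_real (?K N x) * (\<phi> x - \<phi> 0)) = ?K N x * norm (\<phi> x - \<phi> 0)"
        by (simp add: norm_mult)
      also have "\<dots> \<le> ?K N x * (\<eta> + M / \<kappa> * ?W x)"
        using pointwise[OF that] by (intro mult_left_mono) auto
      finally show ?thesis
        unfolding sum_distrib_left[symmetric] by (simp add: algebra_simps)
    qed
    have intD: "set_integrable lborel half_cube (\<lambda>x. of_real (?K N x) * (\<phi> x - \<phi> 0))"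
      unfolding set_integrable_def
    proof (rule Bochner_Integration.integrable_bound[OF intR[unfolded set_integrable_def]])
      show "AE x in lborel. norm (indicator half_cube x *\<^sub>R (of_real (?K N x) * (\<phi> x - \<phi> 0)))
        \<le> norm (indicator half_cube x *\<^sub>R (\<eta> * ?K N x + M / \<kappa> * (\<Sum>i\<in>UNIV. ?K N x * (1 - cos (2 * pi * x $ i)))))"
        using le by (auto intro!: AE_I2 simp: indicator_def intro: order_trans[OF _ abs_ge_self])
    qed measurable
    have intK0: "set_integrable lborel half_cube (\<lambda>x. of_real (?K N x) * \<phi> 0)"
      using intK(1) by (intro set_integrable_mult_left) (auto simp: set_integrable_def scaleR_conv_of_real simp flip: of_real_mult)
    have K0: "(LINT x:half_cube|lborel. of_real (?K N x) * \<phi> 0) = \<phi> 0"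
      using intK(2) by (simp add: set_lebesgue_integral_def scaleR_conv_of_real flip: of_real_mult mult.assoc)
    have "(LINT x:half_cube|lborel. of_real (?K N x) * \<phi> x)
      = (LINT x:half_cube|lborel. of_real (?K N x) * (\<phi> x - \<phi> 0) + of_real (?K N x) * \<phi> 0)"
      by (simp add: algebra_simps)
    also have "\<dots> = (LINT x:half_cube|lborel. of_real (?K N x) * (\<phi> x - \<phi> 0)) + \<phi> 0"
      by (subst set_integral_add(2)[OF intD intK0]) (simp only: K0)
    finally have "dist (LINT x:half_cube|lborel. of_real (?K N x) * \<phi> x) (\<phi> 0)
      = norm (LINT x:half_cube|lborel. of_real (?K N x) * (\<phi> x - \<phi> 0))"
      by (simp add: dist_norm)
    also have "\<dots> \<le> (LINT x:half_cube|lborel. \<eta> * ?K N x + M / \<kappa> * (\<Sum>i\<in>UNIV. ?K N x * (1 - cos (2 * pi * x $ i))))"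
      unfolding set_lebesgue_integral_def
      by (rule norm_integral_le[OF intD[unfolded set_integrable_def] intR[unfolded set_integrable_def]])
        (use le in \<open>auto simp: indicator_def\<close>)
    also have "\<dots> = \<eta> + M / \<kappa> * (\<Sum>i\<in>UNIV. 1 - fejer_coeff N (- axis i 1 :: real ^ 'n))"
    proof -
      have s1: "set_integrable lborel half_cube (\<lambda>x. \<Sum>i\<in>UNIV. ?K N x * (1 - cos (2 * pi * x $ i)))"
        using intC(1) unfolding set_integrable_def scaleR_sum_right
        by (intro Bochner_Integration.integrable_sum) auto
      have s2: "(LINT x:half_cube|lborel. \<Sum>i\<in>UNIV. ?K N x * (1 - cos (2 * pi * x $ i))) = (\<Sum>i\<in>UNIV. 1 - fejer_coeff N (- axis i 1 :: real ^ 'n))"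
        using intC unfolding set_integrable_def set_lebesgue_integral_def scaleR_sum_right
        by (subst Bochner_Integration.integral_sum) auto
      show ?thesis
        using intK(1) s1
        by (subst set_integral_add(2)) (auto simp: intK(2) s2)
    qed
    finally show ?thesis .
  qed
  have "(\<lambda>N. \<eta> + M / \<kappa> * (\<Sum>i\<in>UNIV. 1 - fejer_coeff N (- axis i 1 :: real ^ 'n))) \<longlonglongrightarrow> \<eta> + M / \<kappa> * (\<Sum>i\<in>(UNIV :: 'n set). 1 - 1)"
    by (intro tendsto_intros fejer_coeff_tendsto integer_vectors_uminus)
      (auto simp: integer_vectors_def axis_def)
  then have "\<forall>\<^sub>F N in sequentially. \<eta> + M / \<kappa> * (\<Sum>i\<in>UNIV. 1 - fejer_coeff N (- axis i 1 :: real ^ 'n)) < \<epsilon>"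
    by (rule order_tendstoD) (use \<eta> in \<open>simp add: \<eta>_def\<close>)
  then show "\<forall>\<^sub>F N in sequentially. dist (LINT x:half_cube|lborel. of_real (?K N x) * \<phi> x) (\<phi> 0) < \<epsilon>"
    using eventually_gt_at_top[of 0]
  proof eventually_elim
    case (elim N)
    then show ?case using est[of N] by linarith
  qed
qed

section \<open>Poisson summation\<close>

text \<open>The class of functions to which Poisson summation is applied; it is closed under sums,
  translations, orthogonal maps and bounded continuous factors. The exponent provides one factor
  \<open>1 + (norm x)\<^sup>2 \<ge> 1 + (x $ i)\<^sup>2\<close> for each coordinate, hence
  domination by a multiple of \<open>weight\<close>.\<close>

definition rapid :: "(real ^ 'n \<Rightarrow> complex) \<Rightarrow> bool" where
  "rapid f \<longleftrightarrow> continuous_on UNIV f \<and> (\<exists>C. \<forall>x. norm (f x) * (1 + (norm x)\<^sup>2) ^ CARD('n) \<le> C)"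

text \<open>A majorant of product form, for which integrability over the space and summability over
  \<open>\<int>^n\<close> both reduce to one dimension.\<close>

definition weight :: "real ^ 'n \<Rightarrow> real" where
  "weight x = (\<Prod>i\<in>UNIV. inverse (1 + (x $ i)\<^sup>2))"

lemma weight_nonneg [simp]: "0 \<le> weight x"
  unfolding weight_def by (intro prod_nonneg) auto

lemma rapid_continuous: "rapid f \<Longrightarrow> continuous_on UNIV f"
  by (simp add: rapid_def)

lemma rapid_measurable [measurable_dest]: "rapid f \<Longrightarrow> f \<in> borel_measurable borel"
  by (rule borel_measurable_continuous_onI[OF rapid_continuous])

lemma rapid_le_weight:
  fixes f :: "real ^ 'n \<Rightarrow> complex"
  assumes "rapid f"
  obtains C where "C \<ge> 0" "\<And>x. norm (f x) \<le> C * weight x"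
proof -
  obtain C where C: "\<And>x. norm (f x) * (1 + (norm x)\<^sup>2) ^ CARD('n) \<le> C"
    using assms by (auto simp: rapid_def)
  have "norm (f x) \<le> C * weight x" for x
  proof -
    have pos: "(\<Prod>i\<in>UNIV. 1 + (x $ i)\<^sup>2) > 0" by (intro prod_pos) (auto intro: add_pos_nonneg)
    have "(\<Prod>i\<in>UNIV. 1 + (x $ i)\<^sup>2) \<le> (\<Prod>i\<in>(UNIV :: 'n set). 1 + (norm x)\<^sup>2)"
    proof (intro prod_mono conjI)
      fix i
      have "\<bar>x $ i\<bar> \<le> norm x" by (rule component_le_norm_cart)
      then show "1 + (x $ i)\<^sup>2 \<le> 1 + (norm x)\<^sup>2"
        by (simp add: abs_le_square_iff[symmetric])
    qed auto
    then have "norm (f x) * (\<Prod>i\<in>UNIV. 1 + (x $ i)\<^sup>2) \<le> norm (f x) * (1 + (norm x)\<^sup>2) ^ CARD('n)"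
      by (intro mult_left_mono) auto
    also have "\<dots> \<le> C" by (rule C)
    finally have "norm (f x) * (\<Prod>i\<in>UNIV. 1 + (x $ i)\<^sup>2) \<le> C" .
    moreover have "weight x = inverse (\<Prod>i\<in>UNIV. 1 + (x $ i)\<^sup>2)"
      using prod_inversef[of "\<lambda>i. 1 + (x $ i)\<^sup>2" UNIV] by (simp add: weight_def o_def)
    ultimately show ?thesis
      using pos by (simp add: divide_inverse[symmetric] pos_le_divide_eq)
  qed
  moreover have "C \<ge> 0" using order_trans[OF _ C[of 0]] by simp
  ultimately show thesis using that by blast
qed

lemma integrable_inverse_1_plus_square: "integrable lborel (\<lambda>y::real. inverse (1 + y\<^sup>2))"
proof (rule integrableI_nonneg)
  have half: "(\<integral>\<^sup>+y. ennreal (inverse (1 + y\<^sup>2)) * indicator {0..} y \<partial>lborel) = ennreal (pi / 2 - arctan 0)"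
    by (rule nn_integral_FTC_atLeast[OF _ DERIV_arctan _ tendsto_arctan_at_top]) auto
  have "(\<integral>\<^sup>+y. ennreal (inverse (1 + y\<^sup>2)) \<partial>lborel)
    \<le> (\<integral>\<^sup>+y. ennreal (inverse (1 + y\<^sup>2)) * indicator {0..} y + ennreal (inverse (1 + (- y)\<^sup>2)) * indicator {0..} (- y) \<partial>lborel)"
    by (intro nn_integral_mono) (auto simp: indicator_def)
  also have "\<dots> = (\<integral>\<^sup>+y. ennreal (inverse (1 + y\<^sup>2)) * indicator {0..} y \<partial>lborel)
     + (\<integral>\<^sup>+y. ennreal (inverse (1 + (- y)\<^sup>2)) * indicator {0..} (- y) \<partial>lborel)"
    by (intro nn_integral_add) measurable
  also have "(\<integral>\<^sup>+y. ennreal (inverse (1 + (- y)\<^sup>2)) * indicator {0..} (- y) \<partial>lborel)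
     = (\<integral>\<^sup>+y. ennreal (inverse (1 + y\<^sup>2)) * indicator {0..} (y :: real) \<partial>lborel)"
    by (rule nn_integral_lborel_uminus) measurable
  finally have "(\<integral>\<^sup>+y. ennreal (inverse (1 + y\<^sup>2)) \<partial>lborel) \<le> ennreal (pi / 2) + ennreal (pi / 2)"
    unfolding half by simp
  also have "\<dots> < \<infinity>" by (simp add: ennreal_add_less_top)
  finally show "(\<integral>\<^sup>+y. ennreal (inverse (1 + y\<^sup>2)) \<partial>lborel) < \<infinity>" .
qed auto

lemma integrable_weight: "integrable lborel (weight :: real ^ 'n \<Rightarrow> real)"
proof -
  have "(\<lambda>x::real ^ 'n. \<Prod>b\<in>Basis. inverse (1 + (x \<bullet> b)\<^sup>2)) = weight"
    by (simp add: fun_eq_iff prod_Basis_vec inner_axis weight_def)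
  then show ?thesis
    using integral_lborel_prod(2)[of "\<lambda>(_ :: real ^ 'n) (y :: real). inverse (1 + y\<^sup>2)"] integrable_inverse_1_plus_square
    by simp
qed

lemma rapid_integrable:
  assumes "rapid f"
  shows "integrable lborel f"
proof -
  obtain C where C: "C \<ge> 0" "\<And>x. norm (f x) \<le> C * weight x"
    using rapid_le_weight[OF assms] by blast
  show ?thesis
  proof (rule Bochner_Integration.integrable_bound)
    show "integrable lborel (\<lambda>x. C * weight x)" by (simp add: integrable_weight)
    show "f \<in> borel_measurable lborel" using rapid_measurable[OF assms] by simp
    show "AE x in lborel. norm (f x) \<le> norm (C * weight x)"
      using C by (auto intro!: AE_I2 simp: abs_mult)
  qed
qed

lemma summable_on_weight: "weight summable_on (integer_vectors :: (real ^ 'n) set)"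
proof -
  have "Infinite_Set_Sum.abs_summable_on (\<lambda>g. \<Prod>i\<in>(UNIV :: 'n set). inverse (1 + (of_int (g i))\<^sup>2) :: real) (Pi\<^sub>E UNIV (\<lambda>_. UNIV))"
    by (rule abs_summable_on_prod_PiE) (use summable_on_inverse_1_plus_square_int in \<open>auto simp: abs_summable_equivalent[symmetric]\<close>)
  then have "(\<lambda>g. weight (vec_of_int g :: real ^ 'n)) summable_on UNIV"
    by (simp add: weight_def PiE_UNIV_domain abs_summable_equivalent[symmetric] abs_prod prod_inversef
      flip: prod_inversef)
  then show ?thesis
    unfolding integer_vectors_eq by (subst summable_on_reindex) (auto simp: inj_vec_of_int o_def)
qed

text \<open>Makes the majorant uniform over a cell of the tiling, so that a bound which is summable
  over the lattice points controls the integrals over the cells.\<close>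

lemma weight_half_cube:
  fixes m x :: "real ^ 'n"
  assumes "x \<in> half_cube"
  shows "weight (m + x) \<le> 3 ^ CARD('n) * weight m"
proof -
  have "inverse (1 + ((m + x) $ i)\<^sup>2) \<le> 3 * inverse (1 + (m $ i)\<^sup>2)" for i
  proof -
    have "\<bar>x $ i\<bar> \<le> 1 / 2" using assms unfolding half_cube_def by (simp add: abs_le_iff) (smt (verit) field_sum_of_halves)
    then have "(x $ i)\<^sup>2 \<le> (1 / 2)\<^sup>2" by (metis abs_ge_zero power2_abs power_mono)
    moreover have "(m $ i)\<^sup>2 \<le> 2 * (m $ i + x $ i)\<^sup>2 + 2 * (x $ i)\<^sup>2"
      using zero_le_power2[of "m $ i + 2 * x $ i"] by (simp add: power2_eq_square algebra_simps)
    moreover have "(1 / 2 :: real)\<^sup>2 = 1 / 4" by (simp add: power2_eq_square)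
    \<comment> \<open>The left side is at most \<open>3 / 2 + 2 * (m $ i + x $ i)\<^sup>2\<close>,
      which explains the constant \<open>3\<close>.\<close>
    ultimately have "1 + (m $ i)\<^sup>2 \<le> 3 * (1 + (m $ i + x $ i)\<^sup>2)"
      using zero_le_power2[of "m $ i + x $ i"] unfolding distrib_left by linarith
    moreover have "1 + (m $ i)\<^sup>2 > 0" "1 + (m $ i + x $ i)\<^sup>2 > 0" by (auto intro: add_pos_nonneg)
    ultimately show ?thesis by (simp add: field_simps)
  qed
  then have "weight (m + x) \<le> (\<Prod>i\<in>(UNIV :: 'n set). 3 * inverse (1 + (m $ i)\<^sup>2))"
    unfolding weight_def by (intro prod_mono) auto
  then show ?thesis by (simp add: weight_def prod.distrib)
qed

text \<open>Defined for complex-valued functions because modulation by a character leads out of the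
  real-valued ones.\<close>

definition cfourier :: "(real ^ 'n \<Rightarrow> complex) \<Rightarrow> real ^ 'n \<Rightarrow> complex" where
  "cfourier f \<xi> = (LINT x|lborel. f x * unit_char (- (x \<bullet> \<xi>)))"

lemma integrable_mult_unit_char:
  assumes "integrable lborel f"
  shows "integrable lborel (\<lambda>x::real ^ 'n. f x * unit_char (- (x \<bullet> \<xi>)))"
proof (rule Bochner_Integration.integrable_bound[OF assms])
  have [measurable]: "f \<in> borel_measurable lborel" using assms by simp
  show "(\<lambda>x. f x * unit_char (- (x \<bullet> \<xi>))) \<in> borel_measurable lborel" by measurable
qed (simp add: norm_mult)

lemma rapid_summable:
  assumes "rapid f"
  shows "(\<lambda>x. norm (f x)) summable_on integer_vectors"
proof -
  obtain C where C: "C \<ge> 0" "\<And>x. norm (f x) \<le> C * weight x"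
    using rapid_le_weight[OF assms] by blast
  show ?thesis
    by (rule summable_on_comparison_test[OF summable_on_cmult_right[OF summable_on_weight, of C]]) (auto simp: C)
qed

text \<open>A form of Poisson summation which does not need the Fourier transform to be summable.\<close>

theorem fejer_poisson:
  fixes f :: "real ^ 'n \<Rightarrow> complex"
  assumes f: "rapid f"
  shows "(\<lambda>N. fejer_sum N (cfourier f)) \<longlonglongrightarrow> (\<Sum>\<^sub>\<infinity>m\<in>integer_vectors. f m)"
proof -
  let ?Z = "integer_vectors :: (real ^ 'n) set"
  note [measurable] = rapid_measurable[OF f]
  define m where "m = from_nat_into ?Z"
  have m: "bij_betw m UNIV ?Z"
    unfolding m_def by (rule bij_betw_from_nat_into[OF countable_integer_vectors infinite_integer_vectors])
  have mZ: "m i \<in> ?Z" for i using m by (auto simp: bij_betw_def)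
  obtain C where C: "C \<ge> 0" "\<And>x. norm (f x) \<le> C * weight x"
    using rapid_le_weight[OF f] by blast
  define M where "M i = C * 3 ^ CARD('n) * weight (m i)" for i
  have fM: "norm (f (m i + x)) \<le> M i" if "x \<in> half_cube" for i x
    using order_trans[OF C(2) mult_left_mono[OF weight_half_cube[OF that, of "m i"] C(1)]]
    by (simp add: M_def mult.assoc)
  have "(\<lambda>i. weight (m i)) summable_on UNIV"
    using summable_on_weight summable_on_reindex_bij_betw[OF m] by blast
  then have "summable (\<lambda>i. weight (m i))" by (rule summable_on_imp_summable)
  then have M: "summable M" unfolding M_def by (rule summable_mult)
  \<comment> \<open>The average of \<open>f\<close> over the cell around \<open>m i\<close> with
    respect to the kernel. It tends to \<open>f (m i)\<close> and is bounded by the supremum bound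
    \<open>M i\<close> of the cell, as the kernel is nonnegative with mass one.\<close>
  let ?a = "\<lambda>i N. LINT x:half_cube|lborel. of_real (fejer_kernel N x) * f (m i + x)"
  have cont: "continuous_on UNIV (\<lambda>x. f (m i + x))" for i
    using rapid_continuous[OF f] by (rule continuous_on_compose2) (auto intro!: continuous_intros)
  have lim: "?a i \<longlonglongrightarrow> f (m i)" for i
  proof -
    have "norm (f (m i + x) - f (m i + 0)) \<le> M i + norm (f (m i))" if "x \<in> half_cube" for x
      using norm_triangle_ineq4[of "f (m i + x)" "f (m i)"] fM[OF that, of i] by simp
    from fejer_kernel_tendsto[OF cont this] show ?thesis by simp
  qed
  have a_le: "norm (?a i N) \<le> M i" if N: "N > 0" for i N
  proof -
    have K: "set_integrable lborel half_cube (fejer_kernel N :: real ^ 'n \<Rightarrow> real)"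
      "(LINT x:half_cube|lborel. fejer_kernel N (x :: real ^ 'n)) = 1"
      using N by (simp_all add: fejer_kernel_integral)
    have *: "norm (indicator half_cube x *\<^sub>R (of_real (fejer_kernel N x) * f (m i + x)))
        \<le> M i * (indicator half_cube x *\<^sub>R fejer_kernel N x)" for x
      using fM[of x i] by (auto simp: indicator_def norm_mult mult.commute[of "M i"] intro!: mult_left_mono)
    have int: "integrable lborel (\<lambda>x :: real ^ 'n. M i * (indicator half_cube x *\<^sub>R fejer_kernel N x))"
      using K(1) by (auto simp: set_integrable_def)
    have "norm (?a i N) \<le> (LINT x|lborel. M i * (indicator half_cube x *\<^sub>R fejer_kernel N (x :: real ^ 'n)))"
      unfolding set_lebesgue_integral_def
    proof (rule norm_integral_le[OF _ int *])
      show "integrable lborel (\<lambda>x. indicator half_cube x *\<^sub>R (of_real (fejer_kernel N x) * f (m i + x)))"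
        by (rule Bochner_Integration.integrable_bound[OF int])
          (use * in \<open>auto intro!: AE_I2 intro: order_trans[OF _ abs_ge_self]\<close>)
    qed
    then show ?thesis using K(2) by (simp add: set_lebesgue_integral_def)
  qed
  have "\<forall>\<^sub>F (i, N) in at_top \<times>\<^sub>F at_top. norm (?a i N) \<le> M i"
    unfolding eventually_prod_filter
    by (rule exI[of _ "\<lambda>_. True"], rule exI[of _ "\<lambda>N. N > 0"])
      (auto intro: eventually_gt_at_top a_le)
  \<comment> \<open>The majorant is required only for large \<open>N\<close>; at
    \<open>N = 0\<close> the kernel is identically \<open>0\<close> instead of having mass
    one.\<close>
  from tannerys_theorem[OF lim this M]
  have tann: "(\<lambda>N. \<Sum>i. ?a i N) \<longlonglongrightarrow> (\<Sum>i. f (m i))" by simp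
  \<comment> \<open>A Fejer mean is a finite sum, so it can be drawn into the Fourier integral,
    where it becomes the kernel. Tiling the space and using periodicity of the kernel folds the
    integral onto the cube.\<close>
  have eq: "fejer_sum N (cfourier f) = (\<Sum>i. ?a i N)" for N
  proof -
    let ?B = "int_box N \<times> int_box N :: ((real ^ 'n) \<times> (real ^ 'n)) set"
    have K: "complex_of_real (fejer_kernel N x) = fejer_sum N (\<lambda>k. unit_char (- (x \<bullet> k)))" for x :: "real ^ 'n"
    proof -
      have "complex_of_real (fejer_kernel N x) = cnj (complex_of_real (fejer_kernel N x))" by simp
      also have "\<dots> = fejer_sum N (\<lambda>k. unit_char (- (x \<bullet> k)))"
        unfolding fejer_kernel_eq by (simp add: fejer_sum_def unit_char_minus inner_commute)
      finally show ?thesis .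
    qed
    have fK: "integrable lborel (\<lambda>x. of_real (fejer_kernel N x) * f x)"
    proof -
      have "integrable lborel (\<lambda>x. (\<Sum>p\<in>?B. f x * unit_char (- (x \<bullet> (fst p - snd p)))) / of_nat (N ^ CARD('n)))"
        by (intro integrable_divide Bochner_Integration.integrable_sum integrable_mult_unit_char rapid_integrable f)
      then show ?thesis
        unfolding K fejer_sum_def by (simp add: sum_distrib_left mult.commute[of _ "f _"])
    qed
    have "fejer_sum N (cfourier f) = (LINT x|lborel. (\<Sum>p\<in>?B. f x * unit_char (- (x \<bullet> (fst p - snd p))))) / of_nat (N ^ CARD('n))"
      unfolding fejer_sum_def cfourier_def
      by (subst Bochner_Integration.integral_sum) (auto simp: integrable_mult_unit_char rapid_integrable[OF f])
    also have "\<dots> = (LINT x|lborel. of_real (fejer_kernel N x) * f x)"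
      unfolding K by (subst integral_divide_zero[symmetric]) (simp add: fejer_sum_def sum_distrib_left mult.commute)
    also have "\<dots> = (\<Sum>i. LINT x:half_cube|lborel. of_real (fejer_kernel N (m i + x)) * f (m i + x))"
      by (rule integral_half_cube_tiling[OF m fK])
    finally show ?thesis by (simp add: fejer_kernel_periodic[OF mZ])
  qed
  have "(\<lambda>i. norm (f (m i))) summable_on UNIV"
    using rapid_summable[OF f] summable_on_reindex_bij_betw[OF m, of "\<lambda>x. norm (f x)"] by blast
  then have "((\<lambda>i. f (m i)) has_sum (\<Sum>\<^sub>\<infinity>i. f (m i))) UNIV"
    by (rule has_sum_infsum[OF abs_summable_summable])
  then have "(\<Sum>i. f (m i)) = (\<Sum>\<^sub>\<infinity>i. f (m i))"
    using has_sum_imp_sums sums_unique by metis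
  also have "\<dots> = (\<Sum>\<^sub>\<infinity>x\<in>?Z. f x)"
    by (rule infsum_reindex_bij_betw[OF m])
  finally show ?thesis using tann by (simp add: eq)
qed

section \<open>Rapidly decreasing functions\<close>

text \<open>Dominated convergence for unordered sums. The Weierstrass test makes the finite partial
  sums converge uniformly in \<open>n\<close>, which permits the exchange of the two limits.\<close>

lemma tendsto_infsum_dominated:
  fixes f :: "nat \<Rightarrow> 'a \<Rightarrow> 'b::banach"
  assumes lim: "\<And>x. x \<in> A \<Longrightarrow> (\<lambda>n. f n x) \<longlonglongrightarrow> g x"
    and bound: "\<And>n x. x \<in> A \<Longrightarrow> norm (f n x) \<le> M x" and M: "M summable_on A"
  shows "(\<lambda>n. infsum (f n) A) \<longlonglongrightarrow> infsum g A"
proof (rule swap_uniform_limit'[where S = UNIV])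
  have "norm (g x) \<le> M x" if "x \<in> A" for x
    by (rule Lim_norm_ubound[OF _ lim[OF that]]) (use bound[OF that] in auto)
  then have "(\<lambda>x. norm (g x)) summable_on A"
    using M by (intro Infinite_Sum.abs_summable_on_comparison_test'[OF M])
  then have "g summable_on A" by (rule abs_summable_summable)
  then show "(sum g \<longlongrightarrow> infsum g A) (finite_subsets_at_top A)"
    using has_sum_infsum has_sum_def by blast
  show "\<forall>\<^sub>F X in finite_subsets_at_top A. (\<lambda>n. \<Sum>x\<in>X. f n x) \<longlonglongrightarrow> sum g X"
    by (rule eventually_finite_subsets_at_top_weakI) (auto intro!: tendsto_sum lim)
  show "uniform_limit UNIV (\<lambda>X n. \<Sum>x\<in>X. f n x) (\<lambda>n. infsum (f n) A) (finite_subsets_at_top A)"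
    by (rule Weierstrass_m_test_general[OF bound M])
qed auto

lemma fejer_sum_infsum: "fejer_sum N F = (\<Sum>\<^sub>\<infinity>k\<in>integer_vectors. fejer_coeff N k *\<^sub>R F k)"
proof -
  let ?D = "(\<lambda>p. fst p - snd p) ` (int_box N \<times> int_box N)"
  have z: "fejer_coeff N k = 0" if "k \<notin> ?D" for k
  proof -
    have "{p \<in> int_box N \<times> int_box N. fst p - snd p = k} = {}" using that by force
    then show ?thesis by (simp only: fejer_coeff_def) simp
  qed
  have "((\<lambda>k. fejer_coeff N k *\<^sub>R F k) has_sum fejer_sum N F) integer_vectors"
  proof (rule has_sum_finite_neutralI)
    show "fejer_sum N F = (\<Sum>k\<in>?D. fejer_coeff N k *\<^sub>R F k)" by (rule fejer_sum_eq) auto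
  qed (use z in \<open>auto dest: int_box_integer_vectors intro!: integer_vectors_diff\<close>)
  then show ?thesis by (simp add: infsumI)
qed

text \<open>The weights are at most \<open>1\<close> and tend to \<open>1\<close> at every integer
  vector, so a dominated family has its ordinary sum as the limit of its Fejer means.\<close>

lemma fejer_sum_tendsto:
  fixes F :: "real ^ 'n \<Rightarrow> complex"
  assumes "\<And>k. k \<in> integer_vectors \<Longrightarrow> norm (F k) \<le> M k" "M summable_on integer_vectors"
  shows "(\<lambda>N. fejer_sum N F) \<longlonglongrightarrow> (\<Sum>\<^sub>\<infinity>k\<in>integer_vectors. F k)"
  unfolding fejer_sum_infsum
proof (rule tendsto_infsum_dominated[OF _ _ assms(2)])
  fix k :: "real ^ 'n" assume k: "k \<in> integer_vectors"
  show "(\<lambda>N. fejer_coeff N k *\<^sub>R F k) \<longlonglongrightarrow> F k"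
    using tendsto_scaleR[OF fejer_coeff_tendsto[OF k] tendsto_const[of "F k"]] by simp
  show "norm (fejer_coeff N k *\<^sub>R F k) \<le> M k" for N
  proof -
    have "norm (fejer_coeff N k *\<^sub>R F k) \<le> 1 * norm (F k)"
      using mult_right_mono[OF fejer_coeff_le_1[of N k], of "norm (F k)"] by simp
    with assms(1)[OF k] show ?thesis by simp
  qed
qed

lemma rapid_add:
  assumes "rapid f" "rapid g"
  shows "rapid (\<lambda>x. f x + g x)"
proof -
  obtain C D where CD: "\<And>x. norm (f x) * (1 + (norm x)\<^sup>2) ^ CARD('a) \<le> C" "\<And>x. norm (g x) * (1 + (norm x)\<^sup>2) ^ CARD('a) \<le> D"
    using assms by (auto simp: rapid_def)
  have "norm (f x + g x) * (1 + (norm x)\<^sup>2) ^ CARD('a) \<le> C + D" for x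
  proof -
    have "norm (f x + g x) * (1 + (norm x)\<^sup>2) ^ CARD('a) \<le> (norm (f x) + norm (g x)) * (1 + (norm x)\<^sup>2) ^ CARD('a)"
      by (intro mult_right_mono norm_triangle_ineq) auto
    with CD[of x] show ?thesis by (simp add: distrib_right)
  qed
  moreover have "continuous_on UNIV (\<lambda>x. f x + g x)"
    using assms by (intro continuous_intros) (auto simp: rapid_def)
  ultimately show ?thesis unfolding rapid_def by blast
qed

lemma rapid_mult:
  assumes "rapid f" "continuous_on UNIV c" "\<And>x. norm (c x) \<le> 1"
  shows "rapid (\<lambda>x. c x * f x)"
proof -
  obtain C where C: "\<And>x. norm (f x) * (1 + (norm x)\<^sup>2) ^ CARD('a) \<le> C"
    using assms by (auto simp: rapid_def)
  have "norm (c x * f x) * (1 + (norm x)\<^sup>2) ^ CARD('a) \<le> C" for x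
  proof -
    have "norm (c x) * (norm (f x) * (1 + (norm x)\<^sup>2) ^ CARD('a)) \<le> 1 * (norm (f x) * (1 + (norm x)\<^sup>2) ^ CARD('a))"
      using assms(3) by (intro mult_right_mono) auto
    with C[of x] show ?thesis by (simp add: norm_mult mult.assoc)
  qed
  moreover have "continuous_on UNIV (\<lambda>x. c x * f x)"
    using assms by (intro continuous_intros) (auto simp: rapid_def)
  ultimately show ?thesis unfolding rapid_def by blast
qed

lemma rapid_translate:
  assumes "rapid f"
  shows "rapid (\<lambda>x. f (x + v))"
proof -
  obtain C where C: "\<And>x. norm (f x) * (1 + (norm x)\<^sup>2) ^ CARD('a) \<le> C"
    using assms by (auto simp: rapid_def)
  \<comment> \<open>The constant in Peetre's inequality \<open>1 + (norm x)\<^sup>2 \<le> 2 * (1 +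
    (norm v)\<^sup>2) * (1 + (norm (x + v))\<^sup>2)\<close>.\<close>
  let ?K = "2 * (1 + (norm v)\<^sup>2)"
  have "norm (f (x + v)) * (1 + (norm x)\<^sup>2) ^ CARD('a) \<le> ?K ^ CARD('a) * C" for x
  proof -
    have "norm x \<le> norm (x + v) + norm v"
      using norm_triangle_ineq4[of "x + v" v] by simp
    then have "(norm x)\<^sup>2 \<le> (norm (x + v) + norm v)\<^sup>2" by (intro power_mono) auto
    also have "\<dots> \<le> 2 * (norm (x + v))\<^sup>2 + 2 * (norm v)\<^sup>2"
      using zero_le_power2[of "norm (x + v) - norm v"] by (simp add: power2_eq_square algebra_simps)
    finally have "(norm x)\<^sup>2 \<le> 2 * (norm (x + v))\<^sup>2 + 2 * (norm v)\<^sup>2" .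
    moreover have "?K * (1 + (norm (x + v))\<^sup>2)
      = 2 + 2 * (norm (x + v))\<^sup>2 + 2 * (norm v)\<^sup>2 + 2 * ((norm v)\<^sup>2 * (norm (x + v))\<^sup>2)"
      by (simp add: algebra_simps)
    moreover have "0 \<le> (norm v)\<^sup>2 * (norm (x + v))\<^sup>2" by simp
    ultimately have "1 + (norm x)\<^sup>2 \<le> ?K * (1 + (norm (x + v))\<^sup>2)" by linarith
    then have "(1 + (norm x)\<^sup>2) ^ CARD('a) \<le> (?K * (1 + (norm (x + v))\<^sup>2)) ^ CARD('a)"
      by (intro power_mono) auto
    then have "norm (f (x + v)) * (1 + (norm x)\<^sup>2) ^ CARD('a) \<le> norm (f (x + v)) * (?K * (1 + (norm (x + v))\<^sup>2)) ^ CARD('a)"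
      by (intro mult_left_mono) auto
    also have "\<dots> = ?K ^ CARD('a) * (norm (f (x + v)) * (1 + (norm (x + v))\<^sup>2) ^ CARD('a))"
      by (simp only: power_mult_distrib mult_ac)
    also have "\<dots> \<le> ?K ^ CARD('a) * C" using C by (intro mult_left_mono) auto
    finally show ?thesis .
  qed
  moreover have "continuous_on UNIV (\<lambda>x. f (x + v))"
    using rapid_continuous[OF assms] by (rule continuous_on_compose2) (auto intro!: continuous_intros)
  ultimately show ?thesis unfolding rapid_def by blast
qed

lemma continuous_on_orthogonal:
  "orthogonal_transformation f \<Longrightarrow> continuous_on UNIV (f :: 'a::euclidean_space \<Rightarrow> 'a)"
  by (intro linear_continuous_on linear_conv_bounded_linear[THEN iffD1] orthogonal_transformation_linear)

lemma rapid_orthogonal: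
  fixes U :: "real ^ 'n \<Rightarrow> real ^ 'n"
  assumes "rapid f" "orthogonal_transformation U"
  shows "rapid (\<lambda>x. f (U x))"
proof -
  obtain C where C: "\<And>x. norm (f x) * (1 + (norm x)\<^sup>2) ^ CARD('n) \<le> C"
    using assms by (auto simp: rapid_def)
  have "norm (f (U x)) * (1 + (norm x)\<^sup>2) ^ CARD('n) \<le> C" for x
    using C[of "U x"] orthogonal_transformation_norm[OF assms(2)] by simp
  moreover have "continuous_on UNIV (\<lambda>x. f (U x))"
    using rapid_continuous[OF assms(1)] continuous_on_orthogonal[OF assms(2)] by (rule continuous_on_compose2) auto
  ultimately show ?thesis unfolding rapid_def by blast
qed

lemma rapid_schwartz:
  fixes h :: "real ^ 'n \<Rightarrow> real"
  assumes "schwartz h"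
  shows "rapid (\<lambda>x. complex_of_real (h x))"
proof -
  let ?n = "CARD('n)"
  have "h differentiable (at x)" for x
    using assms unfolding schwartz_def smooth_def
    by (metis foldr_Nil id_apply iterated_partial_def)
  then have "continuous_on UNIV h"
    by (simp add: continuous_at_imp_continuous_on differentiable_imp_continuous_within)
  then have cont: "continuous_on UNIV (\<lambda>x. complex_of_real (h x))" by (intro continuous_intros)
  have "\<exists>C. \<forall>x. norm x ^ k * \<bar>h x\<bar> \<le> C" for k
  proof -
    have "bounded (range (\<lambda>x. norm x ^ k *\<^sub>R iterated_partial [] h x))"
      using assms unfolding schwartz_def by blast
    then show ?thesis
      by (auto simp: bounded_iff iterated_partial_def abs_mult)
  qed
  then obtain C where C: "\<And>k x. norm x ^ k * \<bar>h x\<bar> \<le> C k" by metis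
  \<comment> \<open>Because \<open>(1 + r\<^sup>2) ^ n \<le> 2 ^ n * (1 + r ^ (2 * n))\<close>, the
    decay bounds of orders \<open>0\<close> and \<open>2 * n\<close> combine to the required
    one.\<close>
  have "norm (complex_of_real (h x)) * (1 + (norm x)\<^sup>2) ^ ?n \<le> 2 ^ ?n * (C 0 + C (2 * ?n))" for x
  proof -
    have "(1 + (norm x)\<^sup>2) ^ ?n \<le> (2 * max 1 ((norm x)\<^sup>2)) ^ ?n"
      by (intro power_mono) auto
    also have "\<dots> = 2 ^ ?n * max 1 ((norm x)\<^sup>2) ^ ?n" by (simp add: power_mult_distrib)
    also have "max 1 ((norm x)\<^sup>2) ^ ?n \<le> 1 + norm x ^ (2 * ?n)"
      by (auto simp: max_def power_mult)
    finally have "\<bar>h x\<bar> * (1 + (norm x)\<^sup>2) ^ ?n \<le> \<bar>h x\<bar> * (2 ^ ?n * (1 + norm x ^ (2 * ?n)))"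
      by (intro mult_left_mono) auto
    also have "\<dots> = 2 ^ ?n * (norm x ^ 0 * \<bar>h x\<bar> + norm x ^ (2 * ?n) * \<bar>h x\<bar>)"
      by (simp add: algebra_simps)
    also have "\<dots> \<le> 2 ^ ?n * (C 0 + C (2 * ?n))"
      using C[of x 0] C[of x "2 * ?n"] by (intro mult_left_mono add_mono) auto
    finally show ?thesis by simp
  qed
  with cont show ?thesis unfolding rapid_def by blast
qed

section \<open>Symmetries of the Fourier transform\<close>

lemma fourier_eq_cfourier: "fourier h \<xi> = cfourier (\<lambda>x. complex_of_real (h x)) \<xi>"
  by (simp add: fourier_def cfourier_def unit_char_def cis_conv_exp mult_ac)

lemma cfourier_orthogonal:
  fixes U :: "real ^ 'n \<Rightarrow> real ^ 'n"
  assumes f: "rapid f" and U: "orthogonal_transformation U"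
  shows "cfourier (\<lambda>x. f (U x)) \<xi> = cfourier f (U \<xi>)"
proof -
  note [measurable] = rapid_measurable[OF f] borel_measurable_continuous_onI[OF continuous_on_orthogonal[OF U]]
  have "cfourier f (U \<xi>) = (LINT x|distr lborel borel U. f x * unit_char (- (x \<bullet> U \<xi>)))"
    by (simp add: cfourier_def lborel_distr_orthogonal[OF U])
  also have "\<dots> = (LINT x|lborel. f (U x) * unit_char (- (U x \<bullet> U \<xi>)))"
    by (rule integral_distr) auto
  also have "\<dots> = cfourier (\<lambda>x. f (U x)) \<xi>"
    using U by (simp add: cfourier_def orthogonal_transformation_def)
  finally show ?thesis by simp
qed

lemma cfourier_translate:
  assumes f: "rapid f"
  shows "cfourier (\<lambda>x. f (x + v)) \<xi> = unit_char (v \<bullet> \<xi>) * cfourier f \<xi>"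
proof -
  note [measurable] = rapid_measurable[OF f]
  have "cfourier f \<xi> = (LINT x|distr lborel borel ((+) v). f x * unit_char (- (x \<bullet> \<xi>)))"
    by (simp add: cfourier_def lborel_distr_plus)
  also have "\<dots> = (LINT x|lborel. f (v + x) * unit_char (- ((v + x) \<bullet> \<xi>)))"
    by (rule integral_distr) auto
  also have "(\<lambda>x. f (v + x) * unit_char (- ((v + x) \<bullet> \<xi>))) = (\<lambda>x. unit_char (- (v \<bullet> \<xi>)) * (f (x + v) * unit_char (- (x \<bullet> \<xi>))))"
    by (intro ext) (simp add: inner_add_left unit_char_add add.commute mult_ac flip: unit_char_add)
  also have "(LINT x|lborel. unit_char (- (v \<bullet> \<xi>)) * (f (x + v) * unit_char (- (x \<bullet> \<xi>)))) = unit_char (- (v \<bullet> \<xi>)) * cfourier (\<lambda>x. f (x + v)) \<xi>"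
    unfolding cfourier_def by (rule integral_mult_right_zero)
  finally show ?thesis
    by (simp add: mult.assoc[symmetric] flip: unit_char_add)
qed

lemma cfourier_modulate: "cfourier (\<lambda>x. unit_char (- (x \<bullet> s)) * f x) \<xi> = cfourier f (\<xi> + s)"
  unfolding cfourier_def
  by (simp add: inner_add_right mult_ac flip: unit_char_add)

lemma cfourier_add:
  assumes "rapid f" "rapid g"
  shows "cfourier (\<lambda>x. f x + g x) \<xi> = cfourier f \<xi> + cfourier g \<xi>"
  unfolding cfourier_def distrib_right
  by (rule Bochner_Integration.integral_add) (auto intro: integrable_mult_unit_char rapid_integrable assms)

lemma cfourier_cmult: "cfourier (\<lambda>x. c * f x) \<xi> = c * cfourier f \<xi>"
  unfolding cfourier_def mult.assoc by (rule integral_mult_right_zero)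

section \<open>Slack bounds on rotated copies of the integer lattice\<close>

text \<open>Both sides of Poisson summation are estimated in the same direction while the terms at
  \<open>0\<close> and \<open>v\<close> are kept exactly: on the dual side every other term is
  nonpositive, and on the direct side it is at least the Gaussian. What is left over bounds the two
  slacks at \<open>v\<close> together.\<close>

lemma rapid_gap_bound:
  fixes g :: "real ^ 'n \<Rightarrow> real"
  assumes g: "rapid (\<lambda>x. complex_of_real (g x))" and t: "t > 0"
    and lower: "\<And>m. m \<in> integer_vectors \<Longrightarrow> m \<noteq> 0 \<Longrightarrow> g m \<ge> exp (- t * (norm m)\<^sup>2)"
    and upper: "\<And>m. m \<in> integer_vectors \<Longrightarrow> m \<noteq> 0 \<Longrightarrow> Re (fourier g m) \<le> 0"
    and v: "v \<in> integer_vectors" "v \<noteq> 0"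
  shows "(g v - exp (- t * (norm v)\<^sup>2)) - Re (fourier g v)
    \<le> 1 + Re (fourier g 0) - g 0 - gaussian_mass (integer_vectors :: (real ^ 'n) set) t"
proof -
  let ?Z = "integer_vectors :: (real ^ 'n) set" and ?G = "\<lambda>m::real ^ 'n. exp (- t * (norm m)\<^sup>2)"
  let ?F = "cfourier (\<lambda>x. complex_of_real (g x))"
  have F: "fourier g k = ?F k" for k by (rule fourier_eq_cfourier)
  have "(\<lambda>x. norm (complex_of_real (g x))) summable_on ?Z" by (rule rapid_summable[OF g])
  then have gs: "g summable_on ?Z" by (simp add: abs_summable_summable)
  have "(\<lambda>N. Re (fejer_sum N ?F)) \<longlonglongrightarrow> Re (\<Sum>\<^sub>\<infinity>m\<in>?Z. complex_of_real (g m))"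
    by (intro tendsto_Re fejer_poisson g)
  also have "Re (\<Sum>\<^sub>\<infinity>m\<in>?Z. complex_of_real (g m)) = infsum g ?Z"
    using infsum_Re[OF abs_summable_summable[OF rapid_summable[OF g]]] by simp
  finally have lim: "(\<lambda>N. Re (fejer_sum N ?F)) \<longlonglongrightarrow> infsum g ?Z" .
  \<comment> \<open>Nonnegative weights preserve the sign of the discarded terms, so the estimate
    holds before the limit in \<open>N\<close> is taken, and no convergence of the dual series
    enters.\<close>
  have le: "Re (fejer_sum N ?F) \<le> Re (?F 0) + fejer_coeff N v * Re (?F v)" if N: "N > 0" for N
  proof -
    let ?P = "(\<lambda>p. fst p - snd p) ` (int_box N \<times> int_box N :: ((real ^ 'n) \<times> (real ^ 'n)) set)"
    let ?D = "insert 0 (insert v ?P)"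
    have D: "?D \<subseteq> ?Z" using v by (auto dest: int_box_integer_vectors intro!: integer_vectors_diff)
    have rest: "(\<Sum>k\<in>?D - {0, v}. fejer_coeff N k * Re (?F k)) \<le> 0"
    proof (rule sum_nonpos)
      fix k assume "k \<in> ?D - {0, v}"
      then have "Re (?F k) \<le> 0" using upper[of k] D by (auto simp: F)
      then show "fejer_coeff N k * Re (?F k) \<le> 0" by (simp add: mult_nonneg_nonpos)
    qed
    have "fejer_sum N ?F = (\<Sum>k\<in>?D. fejer_coeff N k *\<^sub>R ?F k)" by (rule fejer_sum_eq) auto
    then have "Re (fejer_sum N ?F) = (\<Sum>k\<in>?D. fejer_coeff N k * Re (?F k))" by simp
    also have "\<dots> = (\<Sum>k\<in>?D - {0, v}. fejer_coeff N k * Re (?F k)) + (\<Sum>k\<in>{0, v}. fejer_coeff N k * Re (?F k))"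
      by (rule sum.subset_diff) auto
    also have "\<dots> \<le> 0 + (Re (?F 0) + fejer_coeff N v * Re (?F v))"
      using v N rest by (intro add_mono) (simp_all add: fejer_coeff_0)
    finally show ?thesis by simp
  qed
  have "(\<lambda>N. Re (?F 0) + fejer_coeff N v * Re (?F v)) \<longlonglongrightarrow> Re (?F 0) + 1 * Re (?F v)"
    by (intro tendsto_intros fejer_coeff_tendsto v)
  then have up: "infsum g ?Z \<le> Re (?F 0) + Re (?F v)"
    using LIMSEQ_le[OF lim] le by (metis (no_types, lifting) Suc_le_lessD mult_1)
  \<comment> \<open>The part of \<open>g\<close> minus the Gaussian that is retained; away from
    \<open>0\<close> and \<open>v\<close> this difference is estimated below by
    \<open>0\<close>.\<close>
  define d where "d m = (if m = 0 then g 0 - 1 else if m = v then g v - ?G v else 0)" for m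
  have d: "(d has_sum (g 0 - 1 + (g v - ?G v))) ?Z"
    by (rule has_sum_finite_neutralI[where B = "{0, v}"]) (use v in \<open>auto simp: d_def\<close>)
  have Gs: "?G summable_on ?Z"
  proof -
    have "?G summable_on (?Z - {0})"
      by (rule summable_on_comparison_test[OF summable_on_subset_banach[OF gs]]) (use lower in auto)
    then have "?G summable_on ({0} \<union> (?Z - {0}))" by (intro summable_on_union) auto
    moreover have "{0} \<union> (?Z - {0}) = ?Z" by auto
    ultimately show ?thesis by metis
  qed
  have "gaussian_mass ?Z t + (g 0 - 1 + (g v - ?G v)) = (\<Sum>\<^sub>\<infinity>m\<in>?Z. ?G m + d m)"
    using infsum_add[OF Gs has_sum_imp_summable[OF d]] infsumI[OF d] by (simp add: gaussian_mass_def)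
  also have "\<dots> \<le> infsum g ?Z"
    by (rule infsum_mono[OF summable_on_add[OF Gs has_sum_imp_summable[OF d]] gs]) (use lower in \<open>auto simp: d_def\<close>)
  finally show ?thesis using up unfolding F by linarith
qed

lemma orthogonal_image_lattice:
  fixes U :: "real ^ 'n \<Rightarrow> real ^ 'n"
  assumes U: "orthogonal_transformation U"
  shows "unimodular_lattice (U ` integer_vectors)" "integral_lattice (U ` integer_vectors)"
proof -
  have lin: "linear U" using U by (rule orthogonal_transformation_linear)
  have det: "\<bar>det (matrix U)\<bar> = 1" using U by simp
  have basis: "lattice_basis (matrix U) (U ` integer_vectors)"
    unfolding lattice_basis_def using det lin by (auto simp: invertible_det_nz matrix_works)
  then show "unimodular_lattice (U ` integer_vectors)"
    unfolding unimodular_lattice_def is_lattice_def using covolume_eq[OF basis] det by auto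
  show "integral_lattice (U ` integer_vectors)"
    unfolding integral_lattice_def is_lattice_def using basis U
    by (auto simp: orthogonal_transformation_def inner_integer_vectors)
qed

text \<open>An orthogonal map \<open>U\<close> with \<open>U v = x\<close> carries the estimate for
  the rotated function at the integer vector \<open>v\<close> over to \<open>x\<close>. Since
  \<open>U\<close> fixes \<open>0\<close>, the quantity \<open>\<epsilon>\<close> is unchanged. Both
  slacks are nonnegative, so a bound on their sum bounds each of them.\<close>

lemma gap_bound:
  fixes h :: "real ^ 'n \<Rightarrow> real" and x v :: "real ^ 'n"
  assumes h: "schwartz h" and t: "t > 0"
    and lower: "\<And>L x. unimodular_lattice L \<Longrightarrow> integral_lattice L \<Longrightarrow> x \<in> L \<Longrightarrow> x \<noteq> 0 \<Longrightarrow> h x \<ge> exp (- t * (norm x)\<^sup>2)"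
    and upper: "\<And>L x. unimodular_lattice L \<Longrightarrow> integral_lattice L \<Longrightarrow> x \<in> L \<Longrightarrow> x \<noteq> 0 \<Longrightarrow> Re (fourier h x) \<le> 0"
    and v: "v \<in> integer_vectors" "norm v = norm x" and x: "x \<noteq> 0"
  defines "\<epsilon> \<equiv> 1 + Re (fourier h 0) - h 0 - gaussian_mass (integer_vectors :: (real ^ 'n) set) t"
  shows "\<bar>h x - exp (- t * (norm x)\<^sup>2)\<bar> \<le> \<epsilon>" "\<bar>Re (fourier h x)\<bar> \<le> \<epsilon>"
proof -
  obtain U where U: "orthogonal_transformation U" "U v = x"
    using orthogonal_transformation_exists[OF v(2)] .
  note L = orthogonal_image_lattice[OF U(1)]
  have U0: "U m = 0 \<longleftrightarrow> m = 0" for m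
    using orthogonal_transformation_norm[OF U(1), of m] by (metis norm_eq_zero)
  note r = rapid_schwartz[OF h]
  have F: "fourier (\<lambda>x. h (U x)) k = fourier h (U k)" for k
    unfolding fourier_eq_cfourier by (rule cfourier_orthogonal[OF r U(1)])
  have "h (U v) - exp (- t * (norm v)\<^sup>2) - Re (fourier (\<lambda>x. h (U x)) v)
    \<le> 1 + Re (fourier (\<lambda>x. h (U x)) 0) - h (U 0) - gaussian_mass (integer_vectors :: (real ^ 'n) set) t"
  proof (rule rapid_gap_bound[OF rapid_orthogonal[OF r U(1)] t])
    fix m :: "real ^ 'n" assume m: "m \<in> integer_vectors" "m \<noteq> 0"
    show "h (U m) \<ge> exp (- t * (norm m)\<^sup>2)"
      using lower[OF L, of "U m"] m U0 orthogonal_transformation_norm[OF U(1), of m] by simp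
    show "Re (fourier (\<lambda>x. h (U x)) m) \<le> 0"
      unfolding F using upper[OF L, of "U m"] m U0 by simp
  qed (use v x in auto)
  moreover have "h x \<ge> exp (- t * (norm x)\<^sup>2)" "Re (fourier h x) \<le> 0"
    using lower[OF L, of x] upper[OF L, of x] U(2) v(1) x by auto
  moreover have "U 0 = 0" using U0 by simp
  ultimately show "\<bar>h x - exp (- t * (norm x)\<^sup>2)\<bar> \<le> \<epsilon>" "\<bar>Re (fourier h x)\<bar> \<le> \<epsilon>"
    unfolding \<epsilon>_def F U(2) v(2) by simp_all
qed

text \<open>\<open>v\<close> is the reflection of \<open>x\<close> in the hyperplane orthogonal to a
  vector of four signs. That vector has squared length \<open>4\<close>, so half of its inner
  product with \<open>x\<close> is subtracted along it. If this inner product is an odd integer,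
  every half-integral coordinate moves by a half-integer and becomes integral.\<close>

lemma four_half_integers:
  fixes x :: "'a \<Rightarrow> real"
  assumes T: "card T = 4" and x: "\<And>i. i \<in> T \<Longrightarrow> x i - 1 / 2 \<in> \<int>"
  obtains v where "\<And>i. i \<in> T \<Longrightarrow> v i \<in> \<int>" "(\<Sum>i\<in>T. (v i)\<^sup>2) = (\<Sum>i\<in>T. (x i)\<^sup>2)"
proof -
  have fin: "finite T" using T by (metis card.infinite zero_neq_numeral)
  obtain a where a: "a \<in> T" using T by fastforce
  have "\<forall>i\<in>T. \<exists>p::int. x i = of_int p + 1 / 2"
    using x by (auto elim!: Ints_cases simp: algebra_simps) (metis add.commute diff_add_cancel x Ints_cases)
  then obtain p :: "'a \<Rightarrow> int" where p: "\<And>i. i \<in> T \<Longrightarrow> x i = of_int (p i) + 1 / 2" by metis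
  have S0: "(\<Sum>i\<in>T. x i) = of_int ((\<Sum>i\<in>T. p i) + 2)"
    using T by (simp add: p sum.distrib)
  \<comment> \<open>If the plain sum of the coordinates is even, flipping the sign at
    \<open>a\<close> changes it by \<open>2 * x a\<close>, which is an odd integer.\<close>
  obtain \<epsilon> :: "'a \<Rightarrow> int" and q :: int where \<epsilon>: "\<And>i. \<epsilon> i = 1 \<or> \<epsilon> i = - 1" and q: "(\<Sum>i\<in>T. of_int (\<epsilon> i) * x i) = of_int (2 * q + 1)"
  proof (cases "odd ((\<Sum>i\<in>T. p i) + 2)")
    case True
    then obtain q where "(\<Sum>i\<in>T. p i) + 2 = 2 * q + 1" by (elim oddE)
    with S0 that[of "\<lambda>_. 1" q] show ?thesis by simp
  next
    case False
    then have "2 dvd (\<Sum>i\<in>T. p i) + 2" by blast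
    then obtain r where r: "(\<Sum>i\<in>T. p i) + 2 = 2 * r" by (elim dvdE)
    have "(\<Sum>i\<in>T. of_int (if i = a then - 1 else 1) * x i) = (\<Sum>i\<in>T. x i - (if i = a then 2 * x i else 0))"
      by (intro sum.cong) auto
    also have "\<dots> = (\<Sum>i\<in>T. x i) - 2 * x a"
      using a fin by (simp add: sum_subtractf)
    also have "\<dots> = of_int (2 * (r - p a - 1) + 1)"
      using S0 r p[OF a] by simp
    finally show ?thesis by (intro that[of "\<lambda>i. if i = a then - 1 else 1" "r - p a - 1"]) auto
  qed
  let ?S = "real_of_int (2 * q + 1)"
  let ?v = "\<lambda>i. x i - ?S / 2 * of_int (\<epsilon> i)"
  have "?v i \<in> \<int>" if "i \<in> T" for i
  proof -
    have "?v i = of_int (if \<epsilon> i = 1 then p i - q else p i + q + 1)"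
      using \<epsilon>[of i] p[OF that] by (auto simp: field_simps)
    then show ?thesis by (metis Ints_of_int)
  qed
  moreover have "(\<Sum>i\<in>T. (?v i)\<^sup>2) = (\<Sum>i\<in>T. (x i)\<^sup>2)"
  proof -
    have "(?v i)\<^sup>2 = (x i)\<^sup>2 - ?S * (of_int (\<epsilon> i) * x i) + ?S\<^sup>2 / 4" for i
      using \<epsilon>[of i] by (auto simp: power2_eq_square field_simps)
    then have "(\<Sum>i\<in>T. (?v i)\<^sup>2) = (\<Sum>i\<in>T. (x i)\<^sup>2) - ?S * (\<Sum>i\<in>T. of_int (\<epsilon> i) * x i) + 4 * (?S\<^sup>2 / 4)"
      using T by (simp add: sum.distrib sum_subtractf sum_distrib_left)
    then show ?thesis unfolding q by (simp add: power2_eq_square)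
  qed
  ultimately show thesis by (rule that)
qed

section \<open>The lattice \<open>E\<^sub>8 \<oplus> \<int>\<^sup>n\<^sup>-\<^sup>8\<close>\<close>

definition half_shift :: "(8 \<Rightarrow> 'n) \<Rightarrow> real ^ 'n" where
  "half_shift e = (\<chi> i. if i \<in> range e then 1 / 2 else 0)"

text \<open>The lattice \<open>D8 \<oplus> \<int>^(n - 8)\<close>. The even coordinate sum is
  expressed as integrality of an inner product, so that averaging a character over two values gives
  the indicator of this lattice within \<open>\<int>^n\<close>.\<close>

definition even_part :: "(8 \<Rightarrow> 'n::finite) \<Rightarrow> (real ^ 'n) set" where
  "even_part e = {m \<in> integer_vectors. m \<bullet> half_shift e \<in> \<int>}"

lemma inner_half_shift: "x \<bullet> half_shift e = (\<Sum>i\<in>range e. x $ i) / 2"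
  unfolding half_shift_def inner_vec_def
  by (simp add: sum_divide_distrib sum.If_cases if_distrib[of "\<lambda>y. _ * y"])

lemma half_shift_square: "inj e \<Longrightarrow> half_shift e \<bullet> half_shift e = 2"
  by (simp add: inner_half_shift[of "half_shift e"]) (simp add: half_shift_def card_image)

lemma Ints_half_iff: "x / 2 \<in> \<int> \<longleftrightarrow> (\<exists>k::int. x = 2 * of_int k)" for x :: real
  by (auto elim!: Ints_cases simp: field_simps)

lemma E8_sum_integers_eq:
  assumes e: "inj e"
  shows "E8_sum_integers e = even_part e \<union> (\<lambda>x. x + half_shift e) ` even_part e"
proof -
  have D8: "(\<chi> i. x $ e i) \<in> D8 \<and> (\<forall>j. j \<notin> range e \<longrightarrow> x $ j \<in> \<int>) \<longleftrightarrow> x \<in> even_part e" for x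
  proof -
    have "(\<Sum>i\<in>range e. x $ i) = (\<Sum>i\<in>UNIV. x $ e i)" using e by (simp add: sum.reindex)
    moreover have "(\<forall>i. x $ e i \<in> \<int>) \<and> (\<forall>j. j \<notin> range e \<longrightarrow> x $ j \<in> \<int>) \<longleftrightarrow> (\<forall>j. x $ j \<in> \<int>)"
      by (metis rangeE rangeI)
    ultimately show ?thesis
      by (auto simp: D8_def even_part_def integer_vectors_def inner_half_shift Ints_half_iff)
  qed
  have "x \<in> E8_sum_integers e \<longleftrightarrow> x \<in> even_part e \<or> x - half_shift e \<in> even_part e" for x
  proof -
    have s: "(\<chi> i. (x - half_shift e) $ e i) = (\<chi> i. x $ e i) - (\<chi> i. 1 / 2)"
      by (simp add: vec_eq_iff half_shift_def)
    have "(\<chi> i. x $ e i) \<in> (\<lambda>x. x + (\<chi> i. 1 / 2)) ` D8 \<longleftrightarrow> (\<chi> i. (x - half_shift e) $ e i) \<in> D8"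
      unfolding s by (auto simp: image_iff) (metis diff_add_cancel)
    moreover have "(\<forall>j. j \<notin> range e \<longrightarrow> x $ j \<in> \<int>) \<longleftrightarrow> (\<forall>j. j \<notin> range e \<longrightarrow> (x - half_shift e) $ j \<in> \<int>)"
      by (simp add: half_shift_def)
    ultimately show ?thesis
      using D8[of x] D8[of "x - half_shift e"] by (simp add: E8_sum_integers_def E8_def) blast
  qed
  moreover have "x \<in> (\<lambda>x. x + half_shift e) ` even_part e \<longleftrightarrow> x - half_shift e \<in> even_part e" for x
    by (auto simp: image_iff) (metis diff_add_cancel)
  ultimately show ?thesis by auto
qed

lemma even_part_disjoint: "even_part e \<inter> (\<lambda>x. x + half_shift e) ` even_part e = {}"
proof (rule ccontr)
  assume "even_part e \<inter> (\<lambda>x. x + half_shift e) ` even_part e \<noteq> {}"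
  then obtain x where "x \<in> integer_vectors" "x + half_shift e \<in> integer_vectors"
    by (auto simp: even_part_def)
  then have "x $ e 0 \<in> \<int>" "(x + half_shift e) $ e 0 \<in> \<int>" by (auto simp: integer_vectors_def)
  then have "(x + half_shift e) $ e 0 - x $ e 0 \<in> \<int>" by (metis Ints_diff)
  then have "(1 / 2 :: real) \<in> \<int>" by (simp add: half_shift_def)
  then show False by (auto elim!: Ints_cases simp: field_simps)
qed

lemma infsum_E8_sum_integers:
  fixes F :: "real ^ 'n \<Rightarrow> 'b::banach"
  assumes e: "inj e" and F: "F summable_on E8_sum_integers e"
  shows "F summable_on even_part e" "(\<lambda>x. F (x + half_shift e)) summable_on even_part e"
    "infsum F (E8_sum_integers e) = (\<Sum>\<^sub>\<infinity>x\<in>even_part e. F x + F (x + half_shift e))"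
proof -
  let ?S = "(\<lambda>x. x + half_shift e) ` even_part e"
  have inj: "inj_on (\<lambda>x. x + half_shift e) (even_part e)" by (auto simp: inj_on_def)
  have 1: "F summable_on even_part e" "F summable_on ?S"
    using F by (auto simp: E8_sum_integers_eq[OF e] intro: summable_on_subset_banach)
  then have 2: "(\<lambda>x. F (x + half_shift e)) summable_on even_part e"
    by (simp add: summable_on_reindex[OF inj] o_def)
  have "infsum F (E8_sum_integers e) = infsum F (even_part e) + infsum F ?S"
    unfolding E8_sum_integers_eq[OF e] by (rule infsum_Un_disjoint[OF 1 even_part_disjoint])
  also have "infsum F ?S = (\<Sum>\<^sub>\<infinity>x\<in>even_part e. F (x + half_shift e))"
    by (simp add: infsum_reindex[OF inj] o_def)
  also have "infsum F (even_part e) + \<dots> = (\<Sum>\<^sub>\<infinity>x\<in>even_part e. F x + F (x + half_shift e))"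
    by (rule infsum_add[symmetric, OF 1(1) 2])
  finally show "F summable_on even_part e" "(\<lambda>x. F (x + half_shift e)) summable_on even_part e"
    "infsum F (E8_sum_integers e) = (\<Sum>\<^sub>\<infinity>x\<in>even_part e. F x + F (x + half_shift e))"
    using 1 2 by auto
qed

lemma summable_on_E8_sum_integers:
  fixes F :: "real ^ 'n \<Rightarrow> 'b::banach"
  assumes e: "inj e" and F: "F summable_on even_part e" "(\<lambda>x. F (x + half_shift e)) summable_on even_part e"
  shows "F summable_on E8_sum_integers e"
  unfolding E8_sum_integers_eq[OF e]
  by (rule summable_on_Un_disjoint[OF _ _ even_part_disjoint]) (use F in \<open>auto simp: summable_on_reindex inj_on_def o_def\<close>)

lemma even_part_subset: "even_part e \<subseteq> integer_vectors"
  by (auto simp: even_part_def)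

text \<open>The inner product is half of an integer \<open>z\<close>, and the character takes the
  value \<open>1\<close> or \<open>- 1\<close> according to the parity of \<open>z\<close>. One sign
  of the argument occurs on the dual side of the summation formula, the other on the direct
  side.\<close>

lemma unit_char_half_shift:
  assumes "m \<in> integer_vectors"
  shows "(1 + unit_char (m \<bullet> half_shift e)) / 2 = (if m \<in> even_part e then 1 else 0)"
    and "(1 + unit_char (- (m \<bullet> half_shift e))) / 2 = (if m \<in> even_part e then 1 else 0)"
proof -
  have "(\<Sum>i\<in>range e. m $ i) \<in> \<int>" using assms by (intro Ints_sum) (auto simp: integer_vectors_def)
  then obtain z where z: "m \<bullet> half_shift e = of_int z / 2" by (auto simp: inner_half_shift elim!: Ints_cases)
  have "unit_char (of_int z / 2) = (if even z then 1 else - 1)"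
  proof (cases "even z")
    case True
    then obtain k where "z = 2 * k" by (rule evenE)
    then show ?thesis by simp
  next
    case False
    then obtain k where k: "z = 2 * k + 1" by (rule oddE)
    have "unit_char (of_int z / 2) = unit_char (of_int k) * unit_char (1 / 2)"
      unfolding unit_char_add[symmetric] by (simp add: k add_divide_distrib)
    also have "\<dots> = - 1" by (simp add: unit_char_def)
    finally show ?thesis using False by simp
  qed
  moreover have "even z \<longleftrightarrow> m \<in> even_part e"
  proof -
    have "real_of_int z = 2 * of_int k \<longleftrightarrow> z = 2 * k" for k by linarith
    then have "m \<bullet> half_shift e \<in> \<int> \<longleftrightarrow> even z" unfolding z Ints_half_iff by (auto simp: dvd_def)
    then show ?thesis using assms by (simp add: even_part_def)
  qed
  ultimately show "(1 + unit_char (m \<bullet> half_shift e)) / 2 = (if m \<in> even_part e then 1 else 0)"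
    "(1 + unit_char (- (m \<bullet> half_shift e))) / 2 = (if m \<in> even_part e then 1 else 0)"
    unfolding unit_char_minus z by simp_all
qed

lemma infsum_even_part:
  "(\<Sum>\<^sub>\<infinity>m\<in>integer_vectors. if m \<in> even_part e then G m else 0) = infsum G (even_part e)"
  by (rule infsum_cong_neutral) (use even_part_subset in auto)

text \<open>
  \<open>E8_sum_integers e\<close> is cut out of \<open>\<int>\<^sup>n \<union> (\<int>\<^sup>n + s)\<close> by the character of \<open>s = half_shift e\<close>, which
  reduces its summation formula to the one for \<open>\<int>\<^sup>n\<close>.
\<close>

lemma poisson_E8_sum_integers:
  fixes f :: "real ^ 'n \<Rightarrow> complex"
  assumes e: "inj e" and f: "rapid f"
    and B: "\<And>x. x \<in> E8_sum_integers e \<Longrightarrow> norm (cfourier f x) \<le> B x" "B summable_on E8_sum_integers e"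
  shows "infsum f (E8_sum_integers e) = infsum (cfourier f) (E8_sum_integers e)"
proof -
  let ?s = "half_shift e" and ?E = "even_part e" and ?Z = "integer_vectors :: (real ^ 'n) set"
  \<comment> \<open>At integer vectors the first factor is the indicator of \<open>?E\<close>, so
    the sum of \<open>?g\<close> over \<open>?Z\<close> is the sum of \<open>f\<close> over
    \<open>?E\<close> and its translate by \<open>?s\<close>.\<close>
  let ?g = "\<lambda>x. (1 + unit_char (- (x \<bullet> ?s))) / 2 * (f x + f (x + ?s))"
  let ?F = "cfourier f"
  have sum: "rapid (\<lambda>x. f x + f (x + ?s))"
    by (intro rapid_add rapid_translate f)
  have g: "rapid ?g"
  proof (rule rapid_mult[OF sum])
    show "norm ((1 + unit_char (- (x \<bullet> ?s))) / 2) \<le> 1" for x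
      using norm_triangle_ineq[of 1 "unit_char (- (x \<bullet> ?s))"] by (simp add: norm_divide)
  qed (intro continuous_intros, simp)
  \<comment> \<open>Translation by \<open>?s\<close> becomes multiplication by a character on the
    dual side, and modulation by \<open>?s\<close> becomes translation. The two exchange roles, so
    the transform of \<open>?g\<close> has the same shape as \<open>?g\<close> itself.\<close>
  have Fg: "cfourier ?g k = (if k \<in> ?E then ?F k + ?F (k + ?s) else 0)" if k: "k \<in> ?Z" for k
  proof -
    have r1: "rapid (\<lambda>x. 1 / 2 * (f x + f (x + ?s)))"
      by (rule rapid_mult[OF sum]) auto
    have r2: "rapid (\<lambda>x. unit_char (- (x \<bullet> ?s)) * (1 / 2 * (f x + f (x + ?s))))"
      by (rule rapid_mult[OF r1]) (auto intro!: continuous_intros)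
    have c: "cfourier (\<lambda>x. 1 / 2 * (f x + f (x + ?s))) \<xi> = 1 / 2 * (1 + unit_char (?s \<bullet> \<xi>)) * ?F \<xi>" for \<xi>
      unfolding cfourier_cmult cfourier_add[OF f rapid_translate[OF f]] cfourier_translate[OF f]
      by (simp add: algebra_simps)
    have "?g = (\<lambda>x. 1 / 2 * (f x + f (x + ?s)) + unit_char (- (x \<bullet> ?s)) * (1 / 2 * (f x + f (x + ?s))))"
      by (intro ext) (simp add: algebra_simps)
    then have "cfourier ?g k = 1 / 2 * (1 + unit_char (?s \<bullet> k)) * ?F k + 1 / 2 * (1 + unit_char (?s \<bullet> (k + ?s))) * ?F (k + ?s)"
      by (simp only: cfourier_add[OF r1 r2] cfourier_modulate c)
    \<comment> \<open>The inner product of \<open>?s\<close> with itself is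
      \<open>8 / 4 = 2\<close>, an integer, so the frequencies \<open>k\<close> and
      \<open>k + ?s\<close> get the same factor. This is where self-duality of the lattice
      enters.\<close>
    also have "unit_char (?s \<bullet> (k + ?s)) = unit_char (?s \<bullet> k)"
      by (simp add: inner_add_right unit_char_add half_shift_square[OF e])
    also have "1 / 2 * (1 + unit_char (?s \<bullet> k)) = (if k \<in> ?E then 1 else 0)"
      using unit_char_half_shift(1)[OF k, of e] by (simp add: inner_commute)
    finally show ?thesis by simp
  qed
  have Fs: "?F summable_on E8_sum_integers e"
    using Infinite_Sum.abs_summable_on_comparison_test'[OF B(2) B(1)] by (rule abs_summable_summable)
  have "(\<lambda>N. fejer_sum N (cfourier ?g)) \<longlonglongrightarrow> (\<Sum>\<^sub>\<infinity>k\<in>?Z. cfourier ?g k)"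
  proof (rule fejer_sum_tendsto)
    let ?M = "\<lambda>k. if k \<in> ?E then B k + B (k + ?s) else 0"
    have "(\<lambda>k. B k + B (k + ?s)) summable_on ?E"
      using infsum_E8_sum_integers(1,2)[OF e B(2)] by (rule summable_on_add)
    then show "?M summable_on ?Z"
      by (rule summable_on_cong_neutral[THEN iffD1, rotated -1]) (use even_part_subset in auto)
    show "norm (cfourier ?g k) \<le> ?M k" if "k \<in> ?Z" for k
    proof (cases "k \<in> ?E")
      case True
      then have "k \<in> E8_sum_integers e" "k + ?s \<in> E8_sum_integers e" by (auto simp: E8_sum_integers_eq[OF e])
      then have "norm (?F k + ?F (k + ?s)) \<le> B k + B (k + ?s)"
        using norm_triangle_ineq[of "?F k" "?F (k + ?s)"] B(1)[of k] B(1)[of "k + ?s"] by linarith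
      with True show ?thesis by (simp only: Fg[OF that]) simp
    qed (simp only: Fg[OF that], simp)
  qed
  then have "(\<Sum>\<^sub>\<infinity>m\<in>?Z. ?g m) = (\<Sum>\<^sub>\<infinity>k\<in>?Z. cfourier ?g k)"
    using fejer_poisson[OF g] LIMSEQ_unique by blast
  also have "\<dots> = (\<Sum>\<^sub>\<infinity>k\<in>?Z. if k \<in> ?E then ?F k + ?F (k + ?s) else 0)"
    by (rule infsum_cong) (rule Fg)
  also have "\<dots> = infsum ?F (E8_sum_integers e)"
    unfolding infsum_even_part infsum_E8_sum_integers(3)[OF e Fs] ..
  also have "(\<Sum>\<^sub>\<infinity>m\<in>?Z. ?g m) = (\<Sum>\<^sub>\<infinity>m\<in>?Z. if m \<in> ?E then f m + f (m + ?s) else 0)"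
    by (rule infsum_cong) (simp only: unit_char_half_shift(2), simp)
  also have "\<dots> = infsum f (E8_sum_integers e)"
  proof -
    have "f summable_on E8_sum_integers e"
    proof (rule summable_on_E8_sum_integers[OF e])
      show "f summable_on ?E"
        using rapid_summable[OF f] by (intro summable_on_subset_banach[OF abs_summable_summable even_part_subset])
      show "(\<lambda>x. f (x + ?s)) summable_on ?E"
        using rapid_summable[OF rapid_translate[OF f]] by (intro summable_on_subset_banach[OF abs_summable_summable even_part_subset])
    qed
    then show ?thesis
      unfolding infsum_even_part using infsum_E8_sum_integers(3)[OF e] by metis
  qed
  finally show ?thesis .
qed

section \<open>The Gaussian mass in terms of theta constants\<close>

lemma infsum_prod_int:
  fixes \<phi> :: "'n::finite \<Rightarrow> int \<Rightarrow> real"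
  assumes "\<And>i. (\<lambda>k. norm (\<phi> i k)) summable_on UNIV"
  shows "(\<lambda>g. \<Prod>i\<in>UNIV. \<phi> i (g i)) summable_on UNIV"
    and "(\<Sum>\<^sub>\<infinity>g. \<Prod>i\<in>UNIV. \<phi> i (g i)) = (\<Prod>i\<in>UNIV. infsum (\<phi> i) UNIV)"
proof -
  have "Infinite_Set_Sum.abs_summable_on (\<lambda>g. \<Prod>i\<in>UNIV. \<phi> i (g i)) (Pi\<^sub>E UNIV (\<lambda>_. UNIV))"
    by (rule abs_summable_on_prod_PiE) (use assms in \<open>auto simp: abs_summable_equivalent[symmetric]\<close>)
  then show "(\<lambda>g. \<Prod>i\<in>UNIV. \<phi> i (g i)) summable_on UNIV"
    by (simp add: abs_summable_equivalent[symmetric] PiE_UNIV_domain abs_summable_summable)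
  show "(\<Sum>\<^sub>\<infinity>g. \<Prod>i\<in>UNIV. \<phi> i (g i)) = (\<Prod>i\<in>UNIV. infsum (\<phi> i) UNIV)"
    using infsum_prod_PiE_abs[of "UNIV :: 'n set" \<phi> "\<lambda>_. UNIV"] assms
    by (simp add: PiE_UNIV_domain)
qed

lemma alt_sign_sum: "finite A \<Longrightarrow> alt_sign (\<Sum>i\<in>A. g i) = (\<Prod>i\<in>A. alt_sign (g i))"
  by (induction A rule: finite_induct) (auto simp: alt_sign_def)

lemma vec_of_int_even_part: "vec_of_int g \<in> even_part e \<longleftrightarrow> even (\<Sum>i\<in>range e. g i)"
proof -
  have "real_of_int z = 2 * of_int k \<longleftrightarrow> z = 2 * k" for k z by linarith
  then show ?thesis
    by (simp add: even_part_def inner_half_shift Ints_half_iff dvd_def flip: of_int_sum)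
qed

text \<open>One coordinate of a Gaussian sum over a translate of \<open>\<int>^n\<close>. The
  offsets that occur are \<open>0\<close>, which gives \<open>theta3\<close>, and
  \<open>1 / 2\<close>, which gives \<open>theta2\<close>.\<close>

definition gaussian_coset_sum :: "real \<Rightarrow> real \<Rightarrow> real" where
  "gaussian_coset_sum t b = (\<Sum>\<^sub>\<infinity>k::int. exp (- t * (of_int k + b)\<^sup>2))"

definition alt_gaussian_coset_sum :: "real \<Rightarrow> real \<Rightarrow> real" where
  "alt_gaussian_coset_sum t b = (\<Sum>\<^sub>\<infinity>k::int. alt_sign k * exp (- t * (of_int k + b)\<^sup>2))"

text \<open>The reflection \<open>k \<mapsto> - 1 - k\<close> preserves the Gaussian factor and
  reverses the sign. In classical terms, Jacobi's first theta function vanishes at the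
  origin.\<close>

lemma alt_gaussian_coset_sum_half: "alt_gaussian_coset_sum t (1 / 2) = 0"
proof -
  let ?f = "\<lambda>k::int. alt_sign k * exp (- t * (of_int k + 1 / 2)\<^sup>2)"
  have bij: "bij_betw (\<lambda>k::int. - 1 - k) UNIV UNIV"
    by (rule bij_betwI[where g = "\<lambda>k. - 1 - k"]) auto
  have "(of_int (- 1 - k) + 1 / 2)\<^sup>2 = (of_int k + 1 / 2 :: real)\<^sup>2" for k
    by (simp add: power2_eq_square algebra_simps)
  then have "?f (- 1 - k) = - ?f k" for k by (simp add: alt_sign_def)
  then have "infsum ?f UNIV = - infsum ?f UNIV"
    using infsum_reindex_bij_betw[OF bij, of ?f] by (simp only: infsum_uminus)
  then show ?thesis by (simp add: alt_gaussian_coset_sum_def)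
qed

lemma exp_norm_vec_of_int:
  "exp (- t * (norm (vec_of_int g + a))\<^sup>2) = (\<Prod>i\<in>UNIV. exp (- t * (of_int (g i) + a $ i)\<^sup>2))"
proof -
  have "(norm (vec_of_int g + a))\<^sup>2 = (\<Sum>i\<in>UNIV. (of_int (g i) + a $ i)\<^sup>2)"
    unfolding power2_norm_eq_inner inner_vec_def by (simp add: power2_eq_square)
  then show ?thesis by (simp add: sum_distrib_left exp_sum flip: sum_negf)
qed

lemma gaussian_integer_vectors:
  fixes a :: "real ^ 'n"
  assumes t: "t > 0"
  shows "(\<lambda>m. exp (- t * (norm (m + a))\<^sup>2)) summable_on integer_vectors"
    and "(\<Sum>\<^sub>\<infinity>m\<in>integer_vectors. exp (- t * (norm (m + a))\<^sup>2)) = (\<Prod>i\<in>UNIV. gaussian_coset_sum t (a $ i))"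
proof -
  have n: "(\<lambda>k::int. norm (exp (- t * (of_int k + a $ i)\<^sup>2))) summable_on UNIV" for i
    using summable_on_gaussian_int[OF t] by simp
  note p = infsum_prod_int[of "\<lambda>i k. exp (- t * (of_int k + a $ i)\<^sup>2)", OF n]
  show "(\<lambda>m. exp (- t * (norm (m + a))\<^sup>2)) summable_on integer_vectors"
    unfolding integer_vectors_eq summable_on_reindex[OF inj_vec_of_int] o_def exp_norm_vec_of_int by (rule p(1))
  show "(\<Sum>\<^sub>\<infinity>m\<in>integer_vectors. exp (- t * (norm (m + a))\<^sup>2)) = (\<Prod>i\<in>UNIV. gaussian_coset_sum t (a $ i))"
    unfolding integer_vectors_eq infsum_reindex[OF inj_vec_of_int] o_def exp_norm_vec_of_int gaussian_coset_sum_def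
    by (rule p(2))
qed

text \<open>The indicator of an even sum is the mean of \<open>1\<close> and a sign. The sign
  factors over the eight coordinates in \<open>range e\<close>, so each half is a product of
  one-dimensional sums.\<close>

lemma gaussian_even_part:
  fixes a :: "real ^ 'n"
  assumes t: "t > 0"
  shows "(\<Sum>\<^sub>\<infinity>m\<in>even_part e. exp (- t * (norm (m + a))\<^sup>2)) =
    ((\<Prod>i\<in>UNIV. gaussian_coset_sum t (a $ i)) +
     (\<Prod>i\<in>UNIV. if i \<in> range e then alt_gaussian_coset_sum t (a $ i) else gaussian_coset_sum t (a $ i))) / 2"
proof -
  let ?p = "\<lambda>i k. exp (- t * (of_int k + a $ i)\<^sup>2)"
  let ?q = "\<lambda>i k. if i \<in> range e then alt_sign k * ?p i k else ?p i k"
  have np: "(\<lambda>k::int. norm (?p i k)) summable_on UNIV" for i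
    using summable_on_gaussian_int[OF t] by simp
  have nq: "(\<lambda>k::int. norm (?q i k)) summable_on UNIV" for i
    by (cases "i \<in> range e") (simp_all only: if_True if_False np summable_on_alt_gaussian_int(2)[OF t])
  note p = infsum_prod_int[of ?p, OF np] and q = infsum_prod_int[of ?q, OF nq]
  have split: "(if vec_of_int g \<in> even_part e then exp (- t * (norm (vec_of_int g + a))\<^sup>2) else 0)
    = ((\<Prod>i\<in>UNIV. ?p i (g i)) + (\<Prod>i\<in>UNIV. ?q i (g i))) / 2" for g
  proof -
    have "(\<Prod>i\<in>UNIV. ?q i (g i)) = (\<Prod>i\<in>UNIV. (if i \<in> range e then alt_sign (g i) else 1) * ?p i (g i))"
      by (intro prod.cong) auto
    also have "\<dots> = (\<Prod>i\<in>range e. alt_sign (g i)) * (\<Prod>i\<in>UNIV. ?p i (g i))"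
      unfolding prod.distrib by (simp add: prod.If_cases)
    also have "(\<Prod>i\<in>range e. alt_sign (g i)) = alt_sign (\<Sum>i\<in>range e. g i)"
      by (rule alt_sign_sum[symmetric]) simp
    finally show ?thesis
      unfolding vec_of_int_even_part exp_norm_vec_of_int by (simp add: alt_sign_def)
  qed
  have inf_q: "infsum (?q i) UNIV = (if i \<in> range e then alt_gaussian_coset_sum t (a $ i) else gaussian_coset_sum t (a $ i))" for i
    by (simp add: alt_gaussian_coset_sum_def gaussian_coset_sum_def)
  have "(\<Sum>\<^sub>\<infinity>m\<in>even_part e. exp (- t * (norm (m + a))\<^sup>2))
    = (\<Sum>\<^sub>\<infinity>m\<in>integer_vectors. if m \<in> even_part e then exp (- t * (norm (m + a))\<^sup>2) else 0)"
    by (rule infsum_even_part[symmetric])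
  also have "\<dots> = (\<Sum>\<^sub>\<infinity>g. ((\<Prod>i\<in>UNIV. ?p i (g i)) + (\<Prod>i\<in>UNIV. ?q i (g i))) / 2)"
    unfolding integer_vectors_eq infsum_reindex[OF inj_vec_of_int] o_def split ..
  also have "\<dots> = ((\<Sum>\<^sub>\<infinity>g. \<Prod>i\<in>UNIV. ?p i (g i)) + (\<Sum>\<^sub>\<infinity>g. \<Prod>i\<in>UNIV. ?q i (g i))) / 2"
    unfolding divide_inverse infsum_cmult_left' infsum_add[OF p(1) q(1)] ..
  finally show ?thesis
    unfolding p(2) q(2) inf_q by (simp only: gaussian_coset_sum_def)
qed

lemma prod_range:
  fixes e :: "8 \<Rightarrow> 'n::finite" and x y :: "'a::comm_monoid_mult"
  assumes "inj e"
  shows "(\<Prod>i\<in>UNIV. if i \<in> range e then x else y) = x ^ 8 * y ^ card (- range e)"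
  using assms by (simp add: prod.If_cases card_image Collect_neg_eq)

text \<open>Apart from the common factor \<open>theta3 t ^ (n - 8)\<close>, which is positive and
  cancels, the even part has mass \<open>(theta3 t ^ 8 + theta4 t ^ 8) / 2\<close> and its translate
  \<open>theta2 t ^ 8 / 2\<close>, because the alternating sum is \<open>0\<close> at offset
  \<open>1 / 2\<close>. Equality with \<open>theta3 t ^ 8\<close> is excluded by
  \<open>theta_E8_neq\<close>.\<close>

lemma gaussian_mass_E8_sum_integers_neq:
  fixes e :: "8 \<Rightarrow> 'n::finite"
  assumes t: "t > 0" and e: "inj e"
  shows "(\<lambda>x. exp (- t * (norm x)\<^sup>2)) summable_on E8_sum_integers e"
    and "gaussian_mass (E8_sum_integers e) t \<noteq> gaussian_mass (integer_vectors :: (real ^ 'n) set) t"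
proof -
  let ?G = "\<lambda>x::real ^ 'n. exp (- t * (norm x)\<^sup>2)" and ?q = "card (- range e)"
  have sum: "?G summable_on even_part e" "(\<lambda>x. ?G (x + half_shift e)) summable_on even_part e"
    using gaussian_integer_vectors(1)[OF t, of 0] gaussian_integer_vectors(1)[OF t, of "half_shift e"]
    by (auto intro: summable_on_subset_banach[OF _ even_part_subset])
  then show s: "?G summable_on E8_sum_integers e"
    by (rule summable_on_E8_sum_integers[OF e])
  have th: "gaussian_coset_sum t 0 = theta3 t" "gaussian_coset_sum t (1 / 2) = theta2 t" "alt_gaussian_coset_sum t 0 = theta4 t"
    by (simp_all add: gaussian_coset_sum_def alt_gaussian_coset_sum_def theta2_def theta3_def theta4_def)
  have Z: "gaussian_mass (integer_vectors :: (real ^ 'n) set) t = theta3 t ^ 8 * theta3 t ^ ?q"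
    using gaussian_integer_vectors(2)[OF t, of "0 :: real ^ 'n"] prod_range[OF e, of "theta3 t" "theta3 t"]
    by (simp add: gaussian_mass_def th)
  have "gaussian_mass (E8_sum_integers e) t = (\<Sum>\<^sub>\<infinity>x\<in>even_part e. ?G (x + 0)) + (\<Sum>\<^sub>\<infinity>x\<in>even_part e. ?G (x + half_shift e))"
    unfolding gaussian_mass_def infsum_E8_sum_integers(3)[OF e s] using infsum_add[OF sum] by simp
  also have "(\<Sum>\<^sub>\<infinity>x\<in>even_part e. ?G (x + 0)) = (theta3 t ^ 8 * theta3 t ^ ?q + theta4 t ^ 8 * theta3 t ^ ?q) / 2"
    unfolding gaussian_even_part[OF t] zero_index th
    using prod_range[OF e, of "theta3 t" "theta3 t"] prod_range[OF e, of "theta4 t" "theta3 t"] by simp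
  also have "(\<Sum>\<^sub>\<infinity>x\<in>even_part e. ?G (x + half_shift e)) = theta2 t ^ 8 * theta3 t ^ ?q / 2"
  proof -
    have 1: "gaussian_coset_sum t (half_shift e $ i) = (if i \<in> range e then theta2 t else theta3 t)" for i
      by (simp add: half_shift_def th)
    have 2: "(if i \<in> range e then alt_gaussian_coset_sum t (half_shift e $ i) else gaussian_coset_sum t (half_shift e $ i))
      = (if i \<in> range e then 0 else theta3 t)" for i
      by (simp add: half_shift_def th alt_gaussian_coset_sum_half)
    show ?thesis
      unfolding gaussian_even_part[OF t] 2 unfolding 1 prod_range[OF e] by simp
  qed
  finally have L: "gaussian_mass (E8_sum_integers e) t = (theta2 t ^ 8 + theta3 t ^ 8 + theta4 t ^ 8) / 2 * theta3 t ^ ?q"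
    by (simp add: field_simps)
  show "gaussian_mass (E8_sum_integers e) t \<noteq> gaussian_mass (integer_vectors :: (real ^ 'n) set) t"
  proof
    assume "gaussian_mass (E8_sum_integers e) t = gaussian_mass (integer_vectors :: (real ^ 'n) set) t"
    then have "(theta2 t ^ 8 + theta3 t ^ 8 + theta4 t ^ 8) / 2 = theta3 t ^ 8"
      using theta_pos(2)[OF t] unfolding L Z mult_cancel_right by simp
    with theta_E8_neq[OF t] show False by simp
  qed
qed

text \<open>In the nontrivial coset exactly the eight coordinates in \<open>range e\<close> are
  half-integral. Any division into two quadruples will do, as \<open>four_half_integers\<close>
  preserves the sum of squares of each.\<close>

lemma E8_sum_integers_norm:
  fixes e :: "8 \<Rightarrow> 'n::finite" and x :: "real ^ 'n"
  assumes e: "inj e" and x: "x \<in> E8_sum_integers e"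
  obtains v :: "real ^ 'n" where "v \<in> integer_vectors" "norm v = norm x"
proof (cases "x \<in> even_part e")
  case True
  with that[of x] show ?thesis by (simp add: even_part_def)
next
  case False
  then obtain m where m: "m \<in> integer_vectors" "x = m + half_shift e"
    using x by (auto simp: E8_sum_integers_eq[OF e] even_part_def)
  have out: "x $ i \<in> \<int>" if "i \<notin> range e" for i
    using m that by (simp add: integer_vectors_def half_shift_def)
  have half: "x $ i - 1 / 2 \<in> \<int>" if "i \<in> range e" for i
    using m that by (simp add: integer_vectors_def half_shift_def)
  have "card (range e) = 8" using e by (simp add: card_image)
  then obtain T where T: "T \<subseteq> range e" "card T = 4"
    using obtain_subset_with_card_n[of 4 "range e"] by auto
  have T': "card (range e - T) = 4"
    using T \<open>card (range e) = 8\<close> by (simp add: card_Diff_subset finite_subset)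
  obtain v where v: "\<And>i. i \<in> T \<Longrightarrow> v i \<in> \<int>" "(\<Sum>i\<in>T. (v i)\<^sup>2) = (\<Sum>i\<in>T. (x $ i)\<^sup>2)"
    using four_half_integers[OF T(2), of "($) x"] half T(1) by blast
  obtain w where w: "\<And>i. i \<in> range e - T \<Longrightarrow> w i \<in> \<int>" "(\<Sum>i\<in>range e - T. (w i)\<^sup>2) = (\<Sum>i\<in>range e - T. (x $ i)\<^sup>2)"
    using four_half_integers[OF T', of "($) x"] half by blast
  define u :: "real ^ 'n" where "u = (\<chi> i. if i \<in> T then v i else if i \<in> range e then w i else x $ i)"
  have split: "(\<Sum>i\<in>UNIV. f i) = (\<Sum>i\<in>T. f i) + (\<Sum>i\<in>range e - T. f i) + (\<Sum>i\<in>- range e. f i)" for f :: "'n \<Rightarrow> real"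
  proof -
    have "(\<Sum>i\<in>UNIV. f i) = (\<Sum>i\<in>UNIV - range e. f i) + (\<Sum>i\<in>range e. f i)"
      by (rule sum.subset_diff) auto
    also have "(\<Sum>i\<in>range e. f i) = (\<Sum>i\<in>range e - T. f i) + (\<Sum>i\<in>T. f i)"
      by (rule sum.subset_diff[OF T(1)]) auto
    finally show ?thesis by (simp add: Compl_eq_Diff_UNIV)
  qed
  have "(\<Sum>i\<in>T. (u $ i)\<^sup>2) = (\<Sum>i\<in>T. (v i)\<^sup>2)" "(\<Sum>i\<in>range e - T. (u $ i)\<^sup>2) = (\<Sum>i\<in>range e - T. (w i)\<^sup>2)"
    "(\<Sum>i\<in>- range e. (u $ i)\<^sup>2) = (\<Sum>i\<in>- range e. (x $ i)\<^sup>2)"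
    using T(1) by (auto intro!: sum.cong simp: u_def)
  then have "(\<Sum>i\<in>UNIV. (u $ i)\<^sup>2) = (\<Sum>i\<in>UNIV. (x $ i)\<^sup>2)"
    unfolding split v(2)[symmetric] w(2)[symmetric] by simp
  then have "norm u = norm x" by (simp add: norm_eq_sqrt_inner inner_vec_def power2_eq_square)
  moreover have "u \<in> integer_vectors"
    using v(1) w(1) out by (auto simp: integer_vectors_def u_def)
  ultimately show ?thesis using that by blast
qed

theorem corollary5p4:
  fixes t :: real and e :: "8 \<Rightarrow> 'n::finite"
  assumes "CARD('n) \<ge> 8" and "t > 0" and "inj e"
  shows "\<not> (\<exists>h :: nat \<Rightarrow> real ^ 'n \<Rightarrow> real.
    (\<forall>j. schwartz (h j) \<and> even_fun (h j)) \<and>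
    (\<forall>j L x. unimodular_lattice L \<and> integral_lattice L \<and> x \<in> L \<and> x \<noteq> 0 \<longrightarrow>
       h j x \<ge> exp (- t * (norm x)\<^sup>2)) \<and>
    (\<forall>j L x. unimodular_lattice L \<and> integral_lattice L \<and> x \<in> L \<and> x \<noteq> 0 \<longrightarrow>
       Re (fourier (h j) x) \<le> 0) \<and>
    (\<lambda>j. 1 + Re (fourier (h j) 0) - h j 0
       - gaussian_mass (integer_vectors :: (real ^ 'n) set) t) \<longlonglongrightarrow> 0 \<and>
    (\<exists>A B :: real ^ 'n \<Rightarrow> real.
       A summable_on E8_sum_integers e \<and> B summable_on E8_sum_integers e \<and>
       (\<forall>x\<in>E8_sum_integers e. A x \<ge> 0 \<and> B x \<ge> 0 \<and>
          (\<forall>j. \<bar>h j x\<bar> \<le> A x \<and> cmod (fourier (h j) x) \<le> B x))))"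
proof (intro notI, elim exE conjE)
  fix h :: "nat \<Rightarrow> real ^ 'n \<Rightarrow> real" and A B :: "real ^ 'n \<Rightarrow> real"
  let ?L = "E8_sum_integers e" and ?G = "\<lambda>x::real ^ 'n. exp (- t * (norm x)\<^sup>2)"
  let ?\<Theta> = "gaussian_mass (integer_vectors :: (real ^ 'n) set) t"
  let ?\<epsilon> = "\<lambda>j. 1 + Re (fourier (h j) 0) - h j 0 - ?\<Theta>"
  assume h: "\<forall>j. schwartz (h j) \<and> even_fun (h j)"
    and lower: "\<forall>j L x. unimodular_lattice L \<and> integral_lattice L \<and> x \<in> L \<and> x \<noteq> 0 \<longrightarrow> h j x \<ge> ?G x"
    and upper: "\<forall>j L x. unimodular_lattice L \<and> integral_lattice L \<and> x \<in> L \<and> x \<noteq> 0 \<longrightarrow> Re (fourier (h j) x) \<le> 0"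
    and \<epsilon>: "?\<epsilon> \<longlonglongrightarrow> 0"
    and A: "A summable_on ?L" and B: "B summable_on ?L"
    and AB: "\<forall>x\<in>?L. A x \<ge> 0 \<and> B x \<ge> 0 \<and> (\<forall>j. \<bar>h j x\<bar> \<le> A x \<and> cmod (fourier (h j) x) \<le> B x)"
  have "0 \<in> ?L"
    by (simp add: E8_sum_integers_eq[OF assms(3)] even_part_def)
  then have L: "?L = {0} \<union> (?L - {0})" by auto
  have split: "infsum f ?L = f 0 + infsum f (?L - {0})" if "f summable_on ?L" for f :: "real ^ 'n \<Rightarrow> real"
  proof -
    have "infsum f ({0} \<union> (?L - {0})) = infsum f {0} + infsum f (?L - {0})"
      using that by (intro infsum_Un_disjoint) (auto intro: summable_on_subset_banach)
    then show ?thesis using L by simp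
  qed
  have conv: "(\<lambda>j. h j x) \<longlonglongrightarrow> ?G x" "(\<lambda>j. Re (fourier (h j) x)) \<longlonglongrightarrow> 0" if x: "x \<in> ?L" "x \<noteq> 0" for x
  proof -
    obtain v :: "real ^ 'n" where v: "v \<in> integer_vectors" "norm v = norm x"
      using E8_sum_integers_norm[OF assms(3) x(1)] .
    have gap: "\<bar>h j x - ?G x\<bar> \<le> ?\<epsilon> j" "\<bar>Re (fourier (h j) x)\<bar> \<le> ?\<epsilon> j" for j
      using gap_bound[of "h j" t v x] h lower upper assms(2) v x(2) by blast+
    have "(\<lambda>j. h j x - ?G x) \<longlonglongrightarrow> 0"
      by (rule Lim_null_comparison[OF _ \<epsilon>]) (use gap in auto)
    then show "(\<lambda>j. h j x) \<longlonglongrightarrow> ?G x" by (rule LIM_zero_cancel)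
    show "(\<lambda>j. Re (fourier (h j) x)) \<longlonglongrightarrow> 0"
      by (rule Lim_null_comparison[OF _ \<epsilon>]) (use gap in auto)
  qed
  have sub: "A summable_on (?L - {0})" "B summable_on (?L - {0})"
    using A B by (auto intro: summable_on_subset_banach)
  have ReF: "\<bar>Re (fourier (h j) x)\<bar> \<le> B x" if "x \<in> ?L" for j x
    using AB that abs_Re_le_cmod order_trans by blast
  \<comment> \<open>The point \<open>0\<close> is left out because the slack bounds say nothing
    about it; the values there are recovered from Poisson summation.\<close>
  have lim_h: "(\<lambda>j. infsum (h j) (?L - {0})) \<longlonglongrightarrow> infsum ?G (?L - {0})"
    by (rule tendsto_infsum_dominated[OF _ _ sub(1)]) (use conv AB in auto)
  have lim_F: "(\<lambda>j. \<Sum>\<^sub>\<infinity>x\<in>?L - {0}. Re (fourier (h j) x)) \<longlonglongrightarrow> (\<Sum>\<^sub>\<infinity>x\<in>?L - {0}. 0)"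
    by (rule tendsto_infsum_dominated[OF _ _ sub(2)]) (use conv ReF in auto)
  \<comment> \<open>Poisson summation with the terms at \<open>0\<close> moved to one side, where
    they form the part of \<open>?\<epsilon> j\<close> that depends on \<open>j\<close>; the limit
    of the other side is already known.\<close>
  have eq: "Re (fourier (h j) 0) - h j 0 = infsum (h j) (?L - {0}) - (\<Sum>\<^sub>\<infinity>x\<in>?L - {0}. Re (fourier (h j) x))" for j
  proof -
    have r: "rapid (\<lambda>x. complex_of_real (h j x))" using h by (simp add: rapid_schwartz)
    have F: "fourier (h j) = cfourier (\<lambda>x. complex_of_real (h j x))" by (intro ext fourier_eq_cfourier)
    have hs: "(\<lambda>x. norm (h j x)) summable_on ?L"
      by (rule Infinite_Sum.abs_summable_on_comparison_test'[OF A]) (use AB in auto)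
    have Fs: "(\<lambda>x. norm (fourier (h j) x)) summable_on ?L"
      by (rule Infinite_Sum.abs_summable_on_comparison_test'[OF B]) (use AB in auto)
    have hs': "h j summable_on ?L" by (rule abs_summable_summable[OF hs])
    have "(\<Sum>\<^sub>\<infinity>x\<in>?L. complex_of_real (h j x)) = infsum (fourier (h j)) ?L"
      unfolding F by (rule poisson_E8_sum_integers[OF assms(3) r _ B]) (use AB in \<open>simp add: F[symmetric]\<close>)
    then have "Re (\<Sum>\<^sub>\<infinity>x\<in>?L. complex_of_real (h j x)) = Re (infsum (fourier (h j)) ?L)" by simp
    moreover have "Re (\<Sum>\<^sub>\<infinity>x\<in>?L. complex_of_real (h j x)) = infsum (h j) ?L"
      using has_sum_of_real[OF has_sum_infsum[OF hs'], where 'a = complex] by (simp add: infsumI)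
    moreover have "Re (infsum (fourier (h j)) ?L) = (\<Sum>\<^sub>\<infinity>x\<in>?L. Re (fourier (h j) x))"
      by (rule infsum_Re[symmetric]) (rule abs_summable_summable[OF Fs])
    ultimately have "infsum (h j) ?L = (\<Sum>\<^sub>\<infinity>x\<in>?L. Re (fourier (h j) x))" by simp
    moreover have "(\<lambda>x. Re (fourier (h j) x)) summable_on ?L"
      by (rule summable_on_Re[OF abs_summable_summable[OF Fs]])
    ultimately show ?thesis
      using split[OF hs'] split[of "\<lambda>x. Re (fourier (h j) x)"] by simp
  qed
  have mass: "infsum ?G (?L - {0}) = gaussian_mass ?L t - 1"
    using split[OF gaussian_mass_E8_sum_integers_neq(1)[OF assms(2,3)]] by (simp add: gaussian_mass_def)
  have "(\<lambda>j. Re (fourier (h j) 0) - h j 0) \<longlonglongrightarrow> gaussian_mass ?L t - 1"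
    unfolding eq using tendsto_diff[OF lim_h lim_F, unfolded mass] by simp
  from tendsto_diff[OF tendsto_add[OF tendsto_const this] tendsto_const]
  have "(\<lambda>j. 1 + (Re (fourier (h j) 0) - h j 0) - ?\<Theta>) \<longlonglongrightarrow> 1 + (gaussian_mass ?L t - 1) - ?\<Theta>" .
  \<comment> \<open>So the limit of \<open>?\<epsilon>\<close> is the difference of the two Gaussian
    masses, which is not \<open>0\<close>.\<close>
  then have "?\<epsilon> \<longlonglongrightarrow> gaussian_mass ?L t - ?\<Theta>"
    by (simp add: add_diff_eq)
  from LIMSEQ_unique[OF this \<epsilon>] gaussian_mass_E8_sum_integers_neq(2)[OF assms(2,3)] show False by simp
qed

end
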